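(* Let $n\in\mathbb{N}$ and let $\widetilde{T}_n=\sum_\gamma v_\gamma\gamma\in\mathcal{R}_n$ represent the $n$-th Hecke operator on periods, and assume that all matrices in $\widetilde{T}_n$ have non-negative entries. Let $x>0$. Then $$(\mathcal{F}_1|_1\widetilde{T}_n)(x)=\sqrt{n}\;d(n)\,\mathcal{F}_1(x),$$ where $d(n)$ is the number of positive divisors of $n$.
   Context: For $x\in\mathbb{C}\setminus(-\infty,0]$, let $$\mathcal{F}_1(x)=\sum_{n=1}^\infty\left\{\psi(nx)+\frac{1}{2nx}-\log(nx)\right\}-\frac12\left(\gamma-\log\left(\frac{2\pi}{x}\right)\right),$$ where $\psi=\Gamma'/\Gamma$ is the digamma function, $\gamma$ is Euler's constant, and $\log$ is the principal branch. Let $\mathcal{M}_n=\{A\in M_{2\times2}(\mathbb{Z})/\{\pm I\}:\det A=n\}$ and let $\mathcal{R}_n=\mathbb{Q}[\mathcal{M}_n]$ be the $\mathbb{Q}$-vector space with basis $\mathcal{M}_n$; $\mathcal{R}=\bigoplus_{n}\mathcal{R}_n$ is a graded ring under matrix multiplication. Let $S=\begin{pmatrix}0&-1\\1&0\end{pmatrix}$ and $T=\begin{pmatrix}1&1\\0&1\end{pmatrix}$, viewed in $\mathcal{M}_1$, and let $$T_n^\infty=\sum_{ad=n}\ \sum_{0\le b<d}\begin{bmatrix}a&b\\0&d\end{bmatrix}\in\mathcal{R}_n$$ (sum over positive $a,d$). An element $\widetilde{T}_n\in\mathcal{R}_n$ represents the $n$-th Hecke operator on periods if $$(1-S)\widetilde{T}_n=T_n^\infty(1-S)+(1-T)Y\quad\text{for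 some }Y\in\mathcal{R}_n.$$ The matrices in $\widetilde{T}_n=\sum_\gamma v_\gamma\gamma$ are those occurring with non-zero coefficient; each is a class modulo $\pm I$, and having non-negative entries means the class has a representative with non-negative entries, which is the representative used below. The weight $k$ slash operator is $$(f|_k\gamma)(x)=\frac{(ad-bc)^{k/2}}{(cx+d)^k}f\left(\frac{ax+b}{cx+d}\right),\qquad\gamma=\begin{pmatrix}a&b\\c&d\end{pmatrix},$$ extended linearly: $f|_k\sum_\gamma v_\gamma\gamma=\sum_\gamma v_\gamma\,(f|_k\gamma)$. *)

theory Defs
  imports "HOL-Analysis.Analysis" "HOL-Library.Poly_Mapping"
begin

text \<open>
  Meaningful only off the closed negative real axis; elsewhere the value is junk.
  The library's \<^const>\<open>Digamma\<close> is the logarithmic derivative of \<^const>\<open>Gamma\<close>, and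
  \<^const>\<open>Ln\<close> is the principal branch.
\<close>
definition F1 :: "complex \<Rightarrow> complex" where
  "F1 x = suminf (\<lambda>m. let n = of_nat (Suc m) in Digamma (n * x) + 1 / (2 * n * x) - Ln (n * x))
          - 1 / 2 * (euler_mascheroni - Ln (2 * of_real pi / x))"

type_synonym imat2 = "int ^ 2 ^ 2"

definition imat :: "int \<Rightarrow> int \<Rightarrow> int \<Rightarrow> int \<Rightarrow> imat2" where
  "imat a b c d = vector [vector [a, b], vector [c, d]]"

text \<open>All \<open>2 \<times> 2\<close> integer matrices, of any determinant, modulo \<open>\<plusminus>I\<close>.\<close>
quotient_type pmat = imat2 / "\<lambda>A B. A = B \<or> A = - B"
  morphisms pmat_rep pmat_class
  by (rule equivpI) (auto intro!: reflpI sympI transpI)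

lift_definition pdet :: "pmat \<Rightarrow> int" is det
  by (auto simp: det_2)

text \<open>
  The library type \<open>'a \<Rightarrow>\<^sub>0 'b\<close> is the monoid ring over \<open>'b\<close> of the monoid \<open>'a\<close>,
  but it takes that monoid in additive notation. So on \<open>pmat\<close> alone the symbols \<open>+\<close> and \<open>0\<close> stand for
  \<^emph>\<open>matrix multiplication\<close> and the class of the \<^emph>\<open>identity\<close> matrix. In \<open>hring\<close> below, \<open>+\<close>, \<open>*\<close>
  and \<open>1\<close> have their usual meaning.
\<close>
instantiation pmat :: monoid_add
begin

lift_definition plus_pmat :: "pmat \<Rightarrow> pmat \<Rightarrow> pmat" is "(**)"
  by (auto simp: matrix_matrix_mult_def vec_eq_iff sum_2)

lift_definition zero_pmat :: pmat is "mat 1" .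

instance
  by standard (transfer; simp add: matrix_mul_assoc)+

end

type_synonym hring = "pmat \<Rightarrow>\<^sub>0 rat"

definition hring_deg :: "nat \<Rightarrow> hring set" where
  "hring_deg n = {v. \<forall>M\<in>Poly_Mapping.keys v. pdet M = int n}"

definition basis :: "imat2 \<Rightarrow> hring" where
  "basis A = Poly_Mapping.single (pmat_class A) 1"

definition S :: hring where
  "S = basis (imat 0 (-1) 1 0)"

definition T :: hring where
  "T = basis (imat 1 1 0 1)"

text \<open>Used for \<open>n > 0\<close>, where the natural numbers \<open>a, d\<close> with \<open>a * d = n\<close> are automatically positive.\<close>
definition T_inf :: "nat \<Rightarrow> hring" where
  "T_inf n = (\<Sum>(a, d) | a * d = n. \<Sum>b<d. basis (imat (int a) (int b) 0 (int d)))"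

definition represents_Hecke :: "nat \<Rightarrow> hring \<Rightarrow> bool" where
  "represents_Hecke n Tn \<longleftrightarrow> Tn \<in> hring_deg n \<and>
     (\<exists>Y\<in>hring_deg n. (1 - S) * Tn = T_inf n * (1 - S) + (1 - T) * Y)"

definition nonneg_mat :: "imat2 \<Rightarrow> bool" where
  "nonneg_mat A \<longleftrightarrow> (\<forall>i j. 0 \<le> A $ i $ j)"

definition has_nonneg_rep :: "pmat \<Rightarrow> bool" where
  "has_nonneg_rep M \<longleftrightarrow> (\<exists>A. pmat_class A = M \<and> nonneg_mat A)"

text \<open>Unique whenever it exists: if \<open>A\<close> and \<open>- A\<close> are both non-negative then \<open>A = 0\<close>.\<close>
definition nonneg_rep :: "pmat \<Rightarrow> imat2" where
  "nonneg_rep M = (THE A. pmat_class A = M \<and> nonneg_mat A)"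

definition slash :: "int \<Rightarrow> (complex \<Rightarrow> complex) \<Rightarrow> imat2 \<Rightarrow> complex \<Rightarrow> complex" where
  "slash k f A x =
     (let a = of_int (A $ 1 $ 1); b = of_int (A $ 1 $ 2);
          c = of_int (A $ 2 $ 1); d = of_int (A $ 2 $ 2)
      in of_real (real_of_int (det A) powr (real_of_int k / 2)) / (c * x + d) powi k
         * f ((a * x + b) / (c * x + d)))"

text \<open>
  For odd \<open>k\<close> the slash operator changes sign under \<open>A \<mapsto> - A\<close>, so the choice of the non-negative
  representative matters; the definition is meaningful only if all classes in \<open>v\<close> have one.
\<close>
definition slash_hring :: "int \<Rightarrow> (complex \<Rightarrow> complex) \<Rightarrow> hring \<Rightarrow> complex \<Rightarrow> complex" where
  "slash_hring k f v x =
     (\<Sum>M\<in>Poly_Mapping.keys v. of_rat (Poly_Mapping.lookup v M) * slash k f (nonneg_rep M) x)"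

end

theory Submission
  imports Defs
begin

text \<open>
  On the upper half plane, F1 is a period function: there is a function \<open>f\<close> with \<open>f (z + 1) = f z\<close> and
  \<open>F1 z = \<pi> * \<i> * (f z - f (- 1 / z) / z)\<close>, in slash notation \<open>F1 = \<pi> * \<i> * f | (1 - S)\<close>. It is the Lambert series
  \<open>f z = - 1/4 + \<Sum> q ^ k / (1 - q ^ k)\<close> with \<open>q = exp (2 * \<pi> * \<i> * z)\<close> (lemma \<open>F1_eq_eis\<close>). Its coefficients are the
  divisor numbers, so it is an eigenfunction: \<open>f | T_inf n = \<surd>n * d(n) * f\<close> (lemma \<open>eis_Hecke\<close>). Slashing \<open>f\<close> with
  both sides of the relation \<open>(1 - S) * Tn = T_inf n * (1 - S) + (1 - T) * Y\<close> gives
  \<open>F1 | Tn = \<surd>n * d(n) * F1\<close>, as \<open>f | (1 - T) = 0\<close>. The slash operator of weight 1 is only defined up to sign on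
  classes modulo \<open>\<plusminus>I\<close>; since the matrices in \<open>Tn\<close> have non-negative entries, signs can be chosen for all
  matrices in the relation so that it remains true (\<open>canonical\<close> and \<open>slash_F1_eq\<close>). Positive
  real points are reached from the upper half plane, using that F1 is continuous there and that
  the matrices in \<open>Tn\<close> preserve the positive half line.

  The period relation is a consequence of two facts on \<open>F1\<close>. First, the reflection formula of the digamma
  function shows that \<open>f z = (F1 z - F1 (- z)) / (2 * \<pi> * \<i>)\<close> (lemma \<open>eis_eq_F1\<close>). Second, Guinand's formula
  \<open>F1 z = F1 (1 / z) / z\<close> holds off the closed negative real axis (lemma \<open>F1_inversion\<close>). For the latter, the series in
  F1 is written as an absolutely convergent sum, over lattice points \<open>k * z + j\<close>, of the errors of the
  trapezoidal rule for the integral of \<open>1 / v\<close> from \<open>k * z + j\<close> to \<open>k * z + j + 1\<close>. Over a square box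
  this sum consists of the double sum of \<open>1 / (k * z + j)\<close>, which is symmetric under \<open>z \<mapsto> 1 / z\<close> up to
  the factor \<open>z\<close>, and of boundary terms. The asymptotics of the latter follow again from the
  trapezoidal rule, and their constants are those of Stirling and Euler.
\<close>

section \<open>Trapezoidal errors\<close>

text \<open>
  The error of the trapezoidal rule for \<open>1 / v\<close> on a segment, as a function of the right endpoint, has
  derivative \<open>- (v - a)\<^sup>2 / (2 * a * v\<^sup>2)\<close>; so the mean value bound gives cubic decay in the distance
  to the origin, which is what makes the lattice sums below converge.
\<close>
lemma trapezoid_inverse:
  fixes a b :: complex
  assumes seg: "closed_segment a b \<inter> \<real>\<^sub>\<le>\<^sub>0 = {}" and m: "m > 0"
    and mle: "\<And>v. v \<in> closed_segment a b \<Longrightarrow> m \<le> norm v"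
  shows "norm (Ln b - Ln a - (b - a) / 2 * (1 / a + 1 / b)) \<le> norm (b - a) ^ 3 / (2 * m ^ 3)"
proof -
  define R where "R = (\<lambda>v. Ln v - Ln a - (v - a) / 2 * (1 / a + 1 / v))"
  have a: "a \<in> closed_segment a b" "b \<in> closed_segment a b" by auto
  have a0: "a \<noteq> 0" using mle[OF a(1)] m by auto
  have "norm (R b - R a) \<le> (norm (b - a) ^ 2 / (2 * m ^ 3)) * norm (b - a)"
  proof (rule field_differentiable_bound[where f' = "\<lambda>v. - (v - a)\<^sup>2 / (2 * a * v\<^sup>2)"])
    fix v assume v: "v \<in> closed_segment a b"
    have v0: "v \<noteq> 0" "v \<notin> \<real>\<^sub>\<le>\<^sub>0" using mle[OF v] m seg v by auto
    show "(R has_field_derivative - (v - a)\<^sup>2 / (2 * a * v\<^sup>2)) (at v within closed_segment a b)"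
      unfolding R_def using v0 a0
      by (auto intro!: derivative_eq_intros simp: field_simps power2_eq_square)
    have "norm (v - a) \<le> norm (b - a)"
      using segment_bound1[OF v] by (simp add: norm_minus_commute)
    moreover have "m * m ^ 2 \<le> norm a * norm v ^ 2"
      using mle[OF v] mle[OF a(1)] m by (intro mult_mono power_mono) auto
    ultimately have "norm (v - a) ^ 2 / (2 * (norm a * norm v ^ 2)) \<le> norm (b - a) ^ 2 / (2 * (m * m ^ 2))"
      using m mle[OF v] mle[OF a(1)] by (intro frac_le mult_mono power_mono) auto
    thus "norm (- (v - a)\<^sup>2 / (2 * a * v\<^sup>2)) \<le> norm (b - a) ^ 2 / (2 * m ^ 3)"
      by (simp add: norm_divide norm_mult norm_power power3_eq_cube power2_eq_square mult.assoc)
  qed (use a in auto)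
  moreover have "R a = 0" by (simp add: R_def)
  ultimately show ?thesis by (simp add: R_def power3_eq_cube power2_eq_square)
qed

text \<open>
  The same for the integrand \<^const>\<open>Ln\<close>. One mean value bound loses a power of \<open>m\<close>, so the derivative \<open>Q\<close> of
  the error is itself bounded by the mean value theorem first.
\<close>
lemma trapezoid_Ln:
  fixes a b :: complex
  assumes seg: "closed_segment a b \<inter> \<real>\<^sub>\<le>\<^sub>0 = {}" and m: "m > 0"
    and mle: "\<And>v. v \<in> closed_segment a b \<Longrightarrow> m \<le> norm v"
  shows "norm ((b * Ln b - b) - (a * Ln a - a) - (b - a) / 2 * (Ln a + Ln b))
           \<le> norm (b - a) ^ 3 / (2 * m ^ 2)"
proof -
  define R where "R = (\<lambda>v. (v * Ln v - v) - (a * Ln a - a) - (v - a) / 2 * (Ln a + Ln v))"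
  define Q where "Q = (\<lambda>v. (Ln v - Ln a) / 2 - (v - a) / (2 * v))"
  have a: "a \<in> closed_segment a b" "b \<in> closed_segment a b" by auto
  have Q: "norm (Q w) \<le> norm (b - a) ^ 2 / (2 * m ^ 2)" if w: "w \<in> closed_segment a b" for w
  proof -
    have "norm (Q w - Q a) \<le> (norm (b - a) / (2 * m ^ 2)) * norm (w - a)"
    proof (rule field_differentiable_bound[where f' = "\<lambda>v. (v - a) / (2 * v\<^sup>2)"])
      fix v assume v: "v \<in> closed_segment a b"
      have v0: "v \<noteq> 0" "v \<notin> \<real>\<^sub>\<le>\<^sub>0" using mle[OF v] m seg v by auto
      show "(Q has_field_derivative (v - a) / (2 * v\<^sup>2)) (at v within closed_segment a b)"
        unfolding Q_def using v0
        by (auto intro!: derivative_eq_intros simp: field_simps power2_eq_square)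
      have "norm (v - a) \<le> norm (b - a)"
        using segment_bound1[OF v] by (simp add: norm_minus_commute)
      moreover have "m ^ 2 \<le> norm v ^ 2" using mle[OF v] m by (intro power_mono) auto
      ultimately show "norm ((v - a) / (2 * v\<^sup>2)) \<le> norm (b - a) / (2 * m ^ 2)"
        using m by (auto simp: norm_divide norm_mult norm_power intro!: frac_le)
    qed (use a w in auto)
    also have "\<dots> \<le> (norm (b - a) / (2 * m ^ 2)) * norm (b - a)"
      using segment_bound1[OF w] by (intro mult_left_mono) (auto simp: norm_minus_commute)
    finally show ?thesis by (simp add: Q_def power2_eq_square)
  qed
  have "norm (R b - R a) \<le> (norm (b - a) ^ 2 / (2 * m ^ 2)) * norm (b - a)"
  proof (rule field_differentiable_bound[where f' = Q])
    fix v assume v: "v \<in> closed_segment a b"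
    have v0: "v \<noteq> 0" "v \<notin> \<real>\<^sub>\<le>\<^sub>0" using mle[OF v] m seg v by auto
    show "(R has_field_derivative Q v) (at v within closed_segment a b)"
      unfolding R_def Q_def using v0
      by (auto intro!: derivative_eq_intros simp: field_simps power2_eq_square)
  qed (use a Q in auto)
  moreover have "R a = 0" by (simp add: R_def)
  ultimately show ?thesis by (simp add: R_def power3_eq_cube power2_eq_square)
qed

section \<open>The digamma series as an absolutely convergent lattice sum\<close>

text \<open>
  The segment from \<open>1\<close> to \<open>z\<close> is compact and misses the origin, so points of the cone spanned by \<open>1\<close> and
  \<open>z\<close> have norm comparable to the sum of their coordinates. Halving the distance leaves room for \<open>z\<close> to
  move in a small disc; this uniformity is used for continuity.
\<close>
lemma cone_lower_bound:
  fixes z :: complex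
  assumes z: "z \<notin> \<real>\<^sub>\<le>\<^sub>0"
  obtains c where "c > 0"
    and "\<And>w s t. w \<in> cball z c \<Longrightarrow> s \<ge> 0 \<Longrightarrow> t \<ge> 0 \<Longrightarrow>
           c * (s + t) \<le> norm (complex_of_real s * w + complex_of_real t)"
proof -
  have "0 \<notin> closed_segment 1 z"
  proof
    assume "0 \<in> closed_segment 1 z"
    then obtain u where u: "0 \<le> u" "u \<le> 1" "0 = (1 - u) *\<^sub>R 1 + u *\<^sub>R z"
      by (auto simp: closed_segment_def)
    have "u \<noteq> 0" using u by auto
    with u have "z = of_real (- (1 - u) / u)"
      by (simp add: scaleR_conv_of_real field_simps add_eq_0_iff)
    moreover have "- (1 - u) / u \<le> 0" using u by (simp add: divide_nonpos_nonneg)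
    ultimately show False using z by (simp add: complex_nonpos_Reals_iff)
  qed
  then obtain d where d: "d > 0" "\<And>y. y \<in> closed_segment 1 z \<Longrightarrow> d \<le> dist 0 y"
    using separate_point_closed[of "closed_segment 1 z" 0] by auto
  show thesis
  proof (rule that[of "d / 2"])
    fix w s t assume w: "w \<in> cball z (d/2)" and s: "(s::real) \<ge> 0" and t: "(t::real) \<ge> 0"
    have 1: "d * (s + t) \<le> norm (complex_of_real s * z + complex_of_real t)"
    proof (cases "s + t = 0")
      case False
      hence st: "s + t > 0" using s t by auto
      define y where "y = (complex_of_real s * z + complex_of_real t) / of_real (s + t)"
      have "y = (1 - s / (s+t)) *\<^sub>R 1 + (s/(s+t)) *\<^sub>R z"
      proof -
        have "1 - s / (s+t) = t / (s+t)" using st by (simp add: field_simps)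
        thus ?thesis unfolding y_def by (simp only: scaleR_conv_of_real) (simp add: add_divide_distrib)
      qed
      hence "y \<in> closed_segment 1 z"
        unfolding closed_segment_def using st s t by (auto intro!: exI[of _ "s/(s+t)"])
      hence "d \<le> norm y" using d(2) by simp
      thus ?thesis using st by (simp add: y_def norm_divide field_simps flip: of_real_add)
    qed (use s t in auto)
    have "norm (complex_of_real s * z + complex_of_real t)
            \<le> norm (complex_of_real s * w + complex_of_real t) + norm (complex_of_real s * (z - w))"
      by (rule order_trans[OF _ norm_triangle_ineq]) (simp add: algebra_simps)
    also have "norm (complex_of_real s * (z - w)) \<le> s * (d / 2)"
      unfolding norm_mult using s w by (intro mult_mono) (auto simp: dist_norm)
    finally have "d * (s + t) - s * (d / 2) \<le> norm (complex_of_real s * w + complex_of_real t)"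
      using 1 by linarith
    moreover have "d / 2 * (s + t) \<le> d * (s + t) - s * (d / 2)"
      using d(1) t by (simp add: field_simps)
    ultimately show "d / 2 * (s + t) \<le> norm (complex_of_real s * w + complex_of_real t)" by linarith
  qed (use d in auto)
qed

lemma cone_avoids_nonpos_Reals:
  fixes w :: complex
  assumes w: "w \<notin> \<real>\<^sub>\<le>\<^sub>0" and "s \<ge> 0" "t \<ge> 0" "s + t > 0"
  shows "complex_of_real s * w + complex_of_real t \<notin> \<real>\<^sub>\<le>\<^sub>0"
  using assms by (auto simp: complex_nonpos_Reals_iff mult_nonneg_nonneg mult_eq_0_iff)
    (smt (verit) mult_nonneg_nonneg mult_pos_pos)

text \<open>
  The trapezoidal error for \<open>1 / v\<close> on the segment from \<open>u\<close> to \<open>u + 1\<close>.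
\<close>
definition trap_err :: "complex \<Rightarrow> complex" where
  "trap_err u = Ln (u + 1) - Ln u - (1 / u + 1 / (u + 1)) / 2"

lemma trap_err_bound:
  fixes w :: complex
  assumes w: "w \<notin> \<real>\<^sub>\<le>\<^sub>0" and c: "c > 0"
    and cone: "\<And>s t. s \<ge> 0 \<Longrightarrow> t \<ge> 0 \<Longrightarrow> c * (s + t) \<le> norm (complex_of_real s * w + complex_of_real t)"
    and s: "s > 0" and t: "t \<ge> 0"
  shows "norm (trap_err (of_real s * w + of_real t)) \<le> 1 / (2 * c ^ 3) * (1 / (s + t) ^ 3)"
proof -
  let ?u = "of_real s * w + of_real t"
  have seg: "v \<notin> \<real>\<^sub>\<le>\<^sub>0 \<and> c * (s + t) \<le> norm v" if v: "v \<in> closed_segment ?u (?u + 1)" for v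
  proof -
    obtain x where x: "0 \<le> x" "x \<le> 1" "v = (1 - x) *\<^sub>R ?u + x *\<^sub>R (?u + 1)"
      using v by (auto simp: closed_segment_def)
    have v: "v = of_real s * w + of_real (t + x)" using x(3) by (simp add: scaleR_conv_of_real algebra_simps)
    have "c * (s + t) \<le> c * (s + (t + x))" using x c by simp
    also have "\<dots> \<le> norm v" unfolding v using s t x by (intro cone) auto
    finally have "c * (s + t) \<le> norm v" .
    moreover have "v \<notin> \<real>\<^sub>\<le>\<^sub>0" unfolding v using s t x w by (intro cone_avoids_nonpos_Reals) auto
    ultimately show ?thesis by auto
  qed
  have "norm (Ln (?u + 1) - Ln ?u - (?u + 1 - ?u) / 2 * (1 / ?u + 1 / (?u + 1)))
          \<le> norm (?u + 1 - ?u) ^ 3 / (2 * (c * (s + t)) ^ 3)"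
    by (rule trapezoid_inverse) (use seg c s t in auto)
  thus ?thesis by (simp add: trap_err_def power_mult_distrib)
qed

text \<open>
  Both coordinates \<open>k + 1\<close> and \<open>j + 1\<close> are at most \<open>k + j + 1\<close>, so the summand is dominated by the product of
  two convergent series with exponent \<open>3/2\<close>.
\<close>
lemma summable_inverse_cube_lattice:
  "(\<lambda>(k, j). 1 / (real (Suc k) + real j) ^ 3) summable_on (UNIV :: (nat \<times> nat) set)"
proof -
  define q where "q = (\<lambda>k. real (Suc k) powr (-3/2))"
  have q: "q summable_on UNIV"
  proof -
    have "summable (\<lambda>n. real n powr (-3/2))" by (simp add: summable_real_powr_iff)
    hence "summable q" unfolding q_def by (subst summable_Suc_iff)
    thus ?thesis by (intro norm_summable_imp_summable_on) (simp add: q_def)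
  qed
  have prod: "(\<lambda>(k, j). q k * q j) summable_on (UNIV \<times> UNIV)"
  proof (rule summable_on_SigmaI)
    show "((\<lambda>j. case (k, j) of (k, j) \<Rightarrow> q k * q j) has_sum q k * infsum q UNIV) UNIV" for k
      using has_sum_cmult_right[OF has_sum_infsum[OF q]] by simp
    show "(\<lambda>k. q k * infsum q UNIV) summable_on UNIV"
      using q by (rule summable_on_cmult_left)
  qed (auto simp: q_def)
  have "(\<lambda>(k, j). 1 / (real (Suc k) + real j) ^ 3) summable_on (UNIV \<times> UNIV)"
  proof (rule summable_on_comparison_test[OF prod])
    fix x :: "nat \<times> nat"
    obtain k j where x: "x = (k, j)" by (cases x)
    define p where "p = real (Suc k) + real j"
    have p: "p > 0" "real (Suc k) \<le> p" "real (Suc j) \<le> p" by (auto simp: p_def)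
    have "p powr (-3/2) * p powr (-3/2) = p powr (-3)"
      by (subst powr_add[symmetric]) simp
    also have "\<dots> = 1 / p ^ 3"
      using p(1) powr_minus[of p 3] powr_numeral[of p "num.Bit1 num.One"] by (simp add: divide_inverse)
    finally have "1 / p ^ 3 = p powr (-3/2) * p powr (-3/2)" ..
    also have "\<dots> \<le> q k * q j"
    proof (rule mult_mono)
      show "p powr (-3/2) \<le> q k" unfolding q_def by (rule powr_mono2') (use p in simp_all)
      show "p powr (-3/2) \<le> q j" unfolding q_def by (rule powr_mono2') (use p in simp_all)
    qed (simp_all add: q_def)
    finally show "(case x of (k, j) \<Rightarrow> 1 / (real (Suc k) + real j) ^ 3) \<le> (case x of (k, j) \<Rightarrow> q k * q j)"
      by (simp add: x p_def)
  qed auto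
  thus ?thesis by simp
qed

text \<open>
  The index \<open>k\<close> is shifted: it stands for the multiple \<open>(k + 1) * z\<close>, so that the sum runs over all pairs of
  naturals.
\<close>
definition lattice_term :: "complex \<Rightarrow> nat \<times> nat \<Rightarrow> complex" where
  "lattice_term z = (\<lambda>(k, j). trap_err (of_nat (Suc k) * z + of_nat j))"

definition digamma_sum :: "complex \<Rightarrow> complex" where
  "digamma_sum z = infsum (lattice_term z) UNIV"

text \<open>
  A single summable majorant works for all points near \<open>z\<close>, as the Weierstrass test requires.
\<close>
lemma lattice_term_bound:
  assumes z: "z \<notin> \<real>\<^sub>\<le>\<^sub>0"
  obtains c M where "c > 0" and "M summable_on (UNIV :: (nat \<times> nat) set)"
    and "\<And>w (kj :: nat \<times> nat). w \<in> cball z c \<Longrightarrow> w \<notin> \<real>\<^sub>\<le>\<^sub>0 \<Longrightarrow> norm (lattice_term w kj) \<le> M kj"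
proof -
  obtain c where c: "c > 0" "\<And>w s t. w \<in> cball z c \<Longrightarrow> s \<ge> 0 \<Longrightarrow> t \<ge> 0 \<Longrightarrow>
           c * (s + t) \<le> norm (complex_of_real s * w + complex_of_real t)"
    using cone_lower_bound[OF z] by metis
  show thesis
  proof (rule that[OF c(1)])
    show "(\<lambda>kj. 1 / (2 * c ^ 3) * (case kj of (k, j) \<Rightarrow> 1 / (real (Suc k) + real j) ^ 3)) summable_on UNIV"
      by (intro summable_on_cmult_right summable_inverse_cube_lattice)
    fix w and kj :: "nat \<times> nat" assume w: "w \<in> cball z c" "w \<notin> \<real>\<^sub>\<le>\<^sub>0"
    obtain k j where kj: "kj = (k, j)" by (cases kj)
    show "norm (lattice_term w kj) \<le> 1 / (2 * c ^ 3) * (case kj of (k, j) \<Rightarrow> 1 / (real (Suc k) + real j) ^ 3)"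
      using trap_err_bound[OF w(2) c(1) c(2)[OF w(1)], of "real (Suc k)" "real j"]
      by (simp add: lattice_term_def kj)
  qed
qed

lemma lattice_term_has_sum:
  assumes z: "z \<notin> \<real>\<^sub>\<le>\<^sub>0"
  shows "(lattice_term z has_sum digamma_sum z) UNIV"
proof -
  obtain c M where c: "c > 0" and M: "M summable_on (UNIV :: (nat \<times> nat) set)"
    and b: "\<And>w kj. w \<in> cball z c \<Longrightarrow> w \<notin> \<real>\<^sub>\<le>\<^sub>0 \<Longrightarrow> norm (lattice_term w kj) \<le> M kj"
    using lattice_term_bound[OF z] by metis
  have "(\<lambda>kj. norm (lattice_term z kj)) summable_on UNIV"
    using b[of z] c z by (intro Infinite_Sum.abs_summable_on_comparison_test'[OF M]) auto
  hence "lattice_term z summable_on UNIV" by (rule abs_summable_summable)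
  thus ?thesis unfolding digamma_sum_def by (rule has_sum_infsum)
qed

lemma trap_err_partial_sum:
  "(\<Sum>j<M. trap_err (w + of_nat j)) =
     Ln (w + of_nat M) - Ln w - (\<Sum>j<M. 1 / (w + of_nat j)) - (1 / (w + of_nat M) - 1 / w) / 2"
proof (induction M)
  case (Suc M)
  have step: "trap_err (w + of_nat M) = Ln (w + of_nat (Suc M)) - Ln (w + of_nat M)
      - (1 / (w + of_nat M) + 1 / (w + of_nat (Suc M))) / 2" by (simp add: trap_err_def add_ac)
  define P P' where "P = 1 / (w + of_nat M)" and "P' = 1 / (w + of_nat (Suc M))"
  show ?case
    unfolding sum.lessThan_Suc Suc.IH step P_def[symmetric] P'_def[symmetric]
    by (simp add: field_simps)
qed auto

text \<open>
  Summing the trapezoidal errors along a ray turns \<open>Ln (w + M) - \<Sum> 1 / (w + j)\<close> into the defining limit of the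
  digamma function; the two end corrections give \<open>1 / (2 * w)\<close>.
\<close>
lemma trap_err_sums:
  assumes w: "w \<notin> \<real>\<^sub>\<le>\<^sub>0"
  shows "(\<lambda>j. trap_err (w + of_nat j)) sums (Digamma w + 1 / (2 * w) - Ln w)"
proof -
  have w0: "w \<noteq> 0" using w by auto
  have nz: "w + of_nat j \<notin> \<real>\<^sub>\<le>\<^sub>0" "w + of_nat j \<noteq> 0" for j
  proof -
    show "w + of_nat j \<notin> \<real>\<^sub>\<le>\<^sub>0" using cone_avoids_nonpos_Reals[OF w, of 1 "real j"] by simp
    thus "w + of_nat j \<noteq> 0" by auto
  qed
  have partial: "(\<Sum>j<M. trap_err (w + of_nat j)) =
      (of_real (ln (real M)) - (\<Sum>j<M. inverse (w + of_nat j))) + (Ln (w + of_nat M) - of_real (ln (real M)))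
      - Ln w - (1 / (w + of_nat M) - 1 / w) / 2" for M
    unfolding trap_err_partial_sum by (simp add: inverse_eq_divide)
  have l1: "(\<lambda>M. Ln (w + of_nat M) - of_real (ln (real M))) \<longlonglongrightarrow> 0"
  proof -
    have "(\<lambda>M. Ln (w / of_nat M + 1)) \<longlonglongrightarrow> Ln (0 + 1)"
      by (intro tendsto_intros tendsto_divide_0[OF tendsto_const] tendsto_of_nat) auto
    moreover have "\<forall>\<^sub>F M in sequentially. Ln (w / of_nat M + 1) = Ln (w + of_nat M) - of_real (ln (real M))"
    proof (rule eventually_mono[OF eventually_gt_at_top[of 0]])
      fix M :: nat assume M: "0 < M"
      have "w + of_nat M = of_real (real M) * (w / of_nat M + 1)" using M by (simp add: field_simps)
      moreover have "w / of_nat M + 1 \<noteq> 0" using nz[of M] M by (simp add: field_simps)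
      ultimately have "Ln (w + of_nat M) = of_real (ln (real M)) + Ln (w / of_nat M + 1)"
        using Ln_times_of_real[of "real M" "w / of_nat M + 1"] M by simp
      thus "Ln (w / of_nat M + 1) = Ln (w + of_nat M) - of_real (ln (real M))" by simp
    qed
    ultimately show ?thesis using Lim_transform_eventually by fastforce
  qed
  have l2: "(\<lambda>M. 1 / (w + of_nat M)) \<longlonglongrightarrow> 0"
    by (intro tendsto_divide_0[OF tendsto_const] tendsto_add_filterlim_at_infinity[OF tendsto_const] tendsto_of_nat)
  have "(\<lambda>M. (of_real (ln (real M)) - (\<Sum>j<M. inverse (w + of_nat j))) + (Ln (w + of_nat M) - of_real (ln (real M)))
      - Ln w - (1 / (w + of_nat M) - 1 / w) / 2) \<longlonglongrightarrow> Digamma w + 0 - Ln w - (0 - 1 / w) / 2"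
    by (intro tendsto_intros Digamma_LIMSEQ w0 l1 l2) auto
  thus ?thesis unfolding sums_def partial using w0 by (simp add: field_simps)
qed

text \<open>
  The inner series of the lattice sum are those of the previous lemma, so the series in \<^const>\<open>F1\<close> is the
  lattice sum.
\<close>
lemma digamma_terms_sums:
  assumes z: "z \<notin> \<real>\<^sub>\<le>\<^sub>0"
  shows "(\<lambda>k. Digamma (of_nat (Suc k) * z) + 1 / (2 * of_nat (Suc k) * z) - Ln (of_nat (Suc k) * z)) sums digamma_sum z"
proof -
  let ?g = "\<lambda>k. Digamma (of_nat (Suc k) * z) + 1 / (2 * of_nat (Suc k) * z) - Ln (of_nat (Suc k) * z)"
  have "(?g has_sum digamma_sum z) UNIV"
  proof (rule has_sum_SigmaD)
    show "(lattice_term z has_sum digamma_sum z) (UNIV \<times> UNIV)" using lattice_term_has_sum[OF z] by simp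
    fix k :: nat
    have kz: "of_nat (Suc k) * z \<notin> \<real>\<^sub>\<le>\<^sub>0" using cone_avoids_nonpos_Reals[OF z, of "real (Suc k)" 0] by simp
    have "lattice_term z summable_on (UNIV \<times> UNIV)"
      using lattice_term_has_sum[OF z] by (auto simp: summable_on_def)
    hence "(\<lambda>j. lattice_term z (k, j)) summable_on UNIV"
      by (intro summable_on_SigmaD1[where f = "\<lambda>k j. lattice_term z (k, j)" and A = UNIV and B = "\<lambda>_. UNIV"]) auto
    then obtain S where S: "((\<lambda>j. lattice_term z (k, j)) has_sum S) UNIV" by (auto simp: summable_on_def)
    have "(\<lambda>j. lattice_term z (k, j)) sums S" by (rule has_sum_imp_sums[OF S])
    moreover have "(\<lambda>j. lattice_term z (k, j)) sums ?g k"
      using trap_err_sums[OF kz] by (simp add: lattice_term_def mult.assoc del: of_nat_Suc)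
    ultimately show "((\<lambda>j. lattice_term z (k, j)) has_sum ?g k) UNIV"
      using S sums_unique2 by blast
  qed
  thus ?thesis by (rule has_sum_imp_sums)
qed

definition log_correction :: "complex \<Rightarrow> complex" where
  "log_correction z = 1 / 2 * (euler_mascheroni - Ln (2 * of_real pi / z))"

lemma F1_eq:
  assumes z: "z \<notin> \<real>\<^sub>\<le>\<^sub>0"
  shows "F1 z = digamma_sum z - log_correction z"
  using digamma_terms_sums[OF z]
  unfolding F1_def log_correction_def Let_def by (simp add: sums_iff)

lemma continuous_digamma_sum:
  assumes z: "z \<notin> \<real>\<^sub>\<le>\<^sub>0"
  shows "isCont digamma_sum z"
proof -
  obtain c M where c: "c > 0" and M: "M summable_on (UNIV :: (nat \<times> nat) set)"
    and b: "\<And>w kj. w \<in> cball z c \<Longrightarrow> w \<notin> \<real>\<^sub>\<le>\<^sub>0 \<Longrightarrow> norm (lattice_term w kj) \<le> M kj"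
    using lattice_term_bound[OF z] by metis
  have op: "open (ball z c - \<real>\<^sub>\<le>\<^sub>0)" by (intro open_Diff) auto
  have "uniform_limit (ball z c - \<real>\<^sub>\<le>\<^sub>0) (\<lambda>X w. \<Sum>kj\<in>X. lattice_term w kj)
          (\<lambda>w. \<Sum>\<^sub>\<infinity>kj. lattice_term w kj) (finite_subsets_at_top UNIV)"
    by (rule Weierstrass_m_test_general[OF _ M]) (use b in auto)
  hence "continuous_on (ball z c - \<real>\<^sub>\<le>\<^sub>0) (\<lambda>w. \<Sum>\<^sub>\<infinity>kj. lattice_term w kj)"
  proof (rule uniform_limit_theorem[rotated])
    have "continuous_on (ball z c - \<real>\<^sub>\<le>\<^sub>0) (\<lambda>w. lattice_term w kj)" for kj
    proof -
      obtain k j where kj: "kj = (k, j)" by (cases kj)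
      have nz: "of_nat (Suc k) * (w :: complex) + of_nat j \<notin> \<real>\<^sub>\<le>\<^sub>0" "of_nat (Suc k) * w + of_nat j + 1 \<notin> \<real>\<^sub>\<le>\<^sub>0" 
        if "w \<notin> \<real>\<^sub>\<le>\<^sub>0" for w
        using cone_avoids_nonpos_Reals[OF that, of "real (Suc k)" "real j"]
          cone_avoids_nonpos_Reals[OF that, of "real (Suc k)" "real j + 1"] by (auto simp: add.assoc)
      have nz': "of_nat (Suc k) * (w :: complex) + of_nat j \<noteq> 0" "of_nat (Suc k) * w + of_nat j + 1 \<noteq> 0" 
        if "w \<notin> \<real>\<^sub>\<le>\<^sub>0" for w
        using nz[OF that] by (metis nonpos_Reals_zero_I)+
      show ?thesis unfolding kj lattice_term_def prod.case trap_err_def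
        by (intro continuous_intros) (use nz nz' in auto)
    qed
    thus "\<forall>\<^sub>F X in finite_subsets_at_top UNIV. continuous_on (ball z c - \<real>\<^sub>\<le>\<^sub>0) (\<lambda>w. \<Sum>kj\<in>X. lattice_term w kj)"
      by (intro always_eventually allI continuous_on_sum) auto
  qed auto
  hence "continuous_on (ball z c - \<real>\<^sub>\<le>\<^sub>0) digamma_sum" by (simp add: digamma_sum_def[abs_def])
  thus ?thesis using op z c by (simp add: continuous_on_eq_continuous_at)
qed

lemma continuous_F1:
  assumes z: "z \<notin> \<real>\<^sub>\<le>\<^sub>0"
  shows "isCont F1 z"
proof -
  have z0: "z \<noteq> 0" using z by auto
  have "2 * of_real pi / z \<notin> \<real>\<^sub>\<le>\<^sub>0"
  proof
    assume "2 * of_real pi / z \<in> \<real>\<^sub>\<le>\<^sub>0"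
    then obtain r where r: "2 * of_real pi / z = of_real r" "r \<le> 0" by (auto elim: nonpos_Reals_cases)
    hence "z = of_real (2 * pi / r)" using z0 by (auto simp: field_simps)
    moreover have "2 * pi / r \<le> 0" using r by (simp add: divide_nonneg_nonpos)
    ultimately show False using z by (metis nonpos_Reals_of_real_iff)
  qed
  hence A: "isCont (\<lambda>z. digamma_sum z - log_correction z) z" unfolding log_correction_def using z0 continuous_digamma_sum[OF z]
    by (intro continuous_intros) auto
  have "\<forall>\<^sub>F w in nhds z. w \<in> - \<real>\<^sub>\<le>\<^sub>0" using z by (intro eventually_nhds_in_open) auto
  hence "\<forall>\<^sub>F w in nhds z. F1 w = digamma_sum w - log_correction w" by eventually_elim (simp add: F1_eq)
  thus ?thesis using A isCont_cong by fast
qed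

section \<open>Finite boxes and their asymptotics\<close>

text \<open>
  The composite trapezoidal rule with step \<open>z\<close> along \<open>v 0, ..., v N\<close>, where \<open>F\<close> plays the role of a primitive
  of \<open>f\<close>. The last term corrects for summing over right endpoints.
\<close>
lemma trapezoid_sum:
  fixes F f :: "complex \<Rightarrow> complex"
  assumes z: "z \<noteq> 0"
    and step: "\<And>k. k < N \<Longrightarrow> norm (F (v (Suc k)) - F (v k) - z / 2 * (f (v k) + f (v (Suc k)))) \<le> E"
  shows "norm ((\<Sum>k<N. f (v (Suc k))) - (F (v N) - F (v 0)) / z - (f (v N) - f (v 0)) / 2) \<le> real N * E / norm z"
proof -
  have "(\<Sum>k<M. F (v (Suc k)) - F (v k) - z / 2 * (f (v k) + f (v (Suc k))))
          = F (v M) - F (v 0) - z * (\<Sum>k<M. f (v (Suc k))) + z * f (v M) / 2 - z * f (v 0) / 2" for M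
    by (induction M) (simp_all add: algebra_simps)
  hence "(\<Sum>k<N. F (v (Suc k)) - F (v k) - z / 2 * (f (v k) + f (v (Suc k))))
          = - z * ((\<Sum>k<N. f (v (Suc k))) - (F (v N) - F (v 0)) / z - (f (v N) - f (v 0)) / 2)"
    using z by (simp add: algebra_simps diff_divide_distrib)
  note telescope = this
  have "norm z * norm ((\<Sum>k<N. f (v (Suc k))) - (F (v N) - F (v 0)) / z - (f (v N) - f (v 0)) / 2)
      = norm (\<Sum>k<N. F (v (Suc k)) - F (v k) - z / 2 * (f (v k) + f (v (Suc k))))"
    unfolding telescope by (simp only: norm_mult norm_minus_cancel)
  also have "\<dots> \<le> (\<Sum>k<N. E)" by (intro sum_norm_le step) auto
  finally show ?thesis using z by (simp add: field_simps)
qed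

lemma Ln_of_nat_mult:
  assumes "n > 0" "w \<noteq> 0"
  shows "Ln (of_nat n * w) = of_real (ln (real n)) + Ln w"
  using Ln_times_of_real[of "real n" w] assms by simp

lemma one_plus_not_nonpos: "z \<notin> \<real>\<^sub>\<le>\<^sub>0 \<Longrightarrow> 1 + z \<notin> \<real>\<^sub>\<le>\<^sub>0" for z :: complex
  using cone_avoids_nonpos_Reals[of z 1 1] by (simp add: add.commute)

text \<open>
  The cells used for the two asymptotic formulas below are the segments between consecutive points
  \<open>N + k * z\<close>; they stay at distance of order \<open>N\<close> from the origin.
\<close>
lemma trapezoid_cells:
  fixes z :: complex
  assumes z: "z \<notin> \<real>\<^sub>\<le>\<^sub>0"
  obtains c where "c > 0"
    and "\<And>N k v. N > 0 \<Longrightarrow> v \<in> closed_segment (of_nat k * z + of_nat N) (of_nat (Suc k) * z + of_nat N) \<Longrightarrow>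
           v \<notin> \<real>\<^sub>\<le>\<^sub>0 \<and> c * real N \<le> norm v"
proof -
  obtain c where c: "c > 0" "\<And>w s t. w \<in> cball z c \<Longrightarrow> s \<ge> 0 \<Longrightarrow> t \<ge> 0 \<Longrightarrow>
           c * (s + t) \<le> norm (complex_of_real s * w + complex_of_real t)"
    using cone_lower_bound[OF z] by metis
  show thesis
  proof (rule that[OF c(1)])
    fix N k :: nat and v assume N: "N > 0"
      and v: "v \<in> closed_segment (of_nat k * z + of_nat N) (of_nat (Suc k) * z + of_nat N)"
    obtain x where x: "0 \<le> x" "x \<le> 1" "v = (1 - x) *\<^sub>R (of_nat k * z + of_nat N) + x *\<^sub>R (of_nat (Suc k) * z + of_nat N)"
      using v by (auto simp: closed_segment_def)
    have v: "v = of_real (real k + x) * z + of_real (real N)"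
      using x(3) by (simp add: scaleR_conv_of_real algebra_simps)
    have "c * real N \<le> c * ((real k + x) + real N)" using x c(1) by simp
    also have "\<dots> \<le> norm v" unfolding v using x c(1) by (intro c) auto
    finally show "v \<notin> \<real>\<^sub>\<le>\<^sub>0 \<and> c * real N \<le> norm v"
      using cone_avoids_nonpos_Reals[OF z, of "real k + x" "real N"] x N v by auto
  qed
qed

text \<open>
  There are \<open>N\<close> cells with an error of order \<open>1 / N\<^sup>2\<close> each. With \<open>L w = w * Ln w - w\<close> the main term is
  \<open>(L (N * (1 + z)) - L N) / z\<close>, written out; \<open>Ln (1 + z) / 2\<close> is the end correction.
\<close>
lemma sum_Ln_asymptotic:
  assumes z: "z \<notin> \<real>\<^sub>\<le>\<^sub>0"
  shows "(\<lambda>N. (\<Sum>k<N. Ln (of_nat (Suc k) * z + of_nat N))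
            - (of_real (real N * ln (real N) - real N) + of_nat N * (1 + 1 / z) * Ln (1 + z) + Ln (1 + z) / 2))
         \<longlonglongrightarrow> 0"
proof -
  obtain c where c: "c > 0"
    and cell: "\<And>N k v. N > 0 \<Longrightarrow> v \<in> closed_segment (of_nat k * z + of_nat N) (of_nat (Suc k) * z + of_nat N) \<Longrightarrow>
           v \<notin> \<real>\<^sub>\<le>\<^sub>0 \<and> c * real N \<le> norm v"
    using trapezoid_cells[OF z] by metis
  have z0: "z \<noteq> 0" "1 + z \<noteq> 0" using z one_plus_not_nonpos[OF z] by auto
  have bound: "norm ((\<Sum>k<N. Ln (of_nat (Suc k) * z + of_nat N))
            - (of_real (real N * ln (real N) - real N) + of_nat N * (1 + 1 / z) * Ln (1 + z) + Ln (1 + z) / 2))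
          \<le> norm z ^ 2 / (2 * c ^ 2) * (1 / real N)" if N: "N > 0" for N
  proof -
    define v where "v = (\<lambda>k. of_nat k * z + of_nat N)"
    define L where "L = (\<lambda>w. w * Ln w - w)"
    have "norm (L (v (Suc k)) - L (v k) - z / 2 * (Ln (v k) + Ln (v (Suc k)))) \<le> norm z ^ 3 / (2 * (c * real N) ^ 2)" for k
    proof -
      have "v (Suc k) - v k = z" by (simp add: v_def algebra_simps)
      moreover have "norm ((v (Suc k) * Ln (v (Suc k)) - v (Suc k)) - (v k * Ln (v k) - v k)
           - (v (Suc k) - v k) / 2 * (Ln (v k) + Ln (v (Suc k)))) \<le> norm (v (Suc k) - v k) ^ 3 / (2 * (c * real N) ^ 2)"
        by (rule trapezoid_Ln) (use cell[OF N] c N in \<open>auto simp: v_def\<close>)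
      ultimately show ?thesis by (simp add: L_def)
    qed
    from trapezoid_sum[where v = v and F = L and f = Ln, OF z0(1) this, of N]
    have "norm ((\<Sum>k<N. Ln (v (Suc k))) - (L (v N) - L (v 0)) / z - (Ln (v N) - Ln (v 0)) / 2)
            \<le> real N * (norm z ^ 3 / (2 * (c * real N) ^ 2)) / norm z" .
    also have "\<dots> = norm z ^ 2 / (2 * c ^ 2) * (1 / real N)"
      using z0 c N by (simp add: field_simps power2_eq_square power3_eq_cube)
    also have "v 0 = of_nat N" by (simp add: v_def)
    also have "v N = of_nat N * (1 + z)" by (simp add: v_def algebra_simps)
    also have "L (of_nat N * (1 + z)) = of_nat N * (1 + z) * (of_real (ln (real N)) + Ln (1 + z)) - of_nat N * (1 + z)"
      using N z0 by (simp add: L_def Ln_of_nat_mult)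
    also have "Ln (of_nat N * (1 + z)) = of_real (ln (real N)) + Ln (1 + z)"
      using N z0 by (simp add: Ln_of_nat_mult)
    also have "L (of_nat N) = of_nat N * of_real (ln (real N)) - of_nat N" using N by (simp add: L_def)
    also have "Ln (of_nat N) = of_real (ln (real N))" using N by simp
    also have "(of_nat N * (1 + z) * (of_real (ln (real N)) + Ln (1 + z)) - of_nat N * (1 + z) -
                (of_nat N * of_real (ln (real N)) - of_nat N)) / z
             = of_real (real N * ln (real N) - real N) + of_nat N * (1 + 1 / z) * Ln (1 + z)"
      using z0 by (simp add: field_simps)
    finally show ?thesis by (simp add: v_def algebra_simps)
  qed
  have "(\<lambda>N. norm z ^ 2 / (2 * c ^ 2) * (1 / real N)) \<longlonglongrightarrow> norm z ^ 2 / (2 * c ^ 2) * 0"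
    by (intro tendsto_mult_left lim_1_over_n)
  hence lim: "(\<lambda>N. norm z ^ 2 / (2 * c ^ 2) * (1 / real N)) \<longlonglongrightarrow> 0" by (simp only: mult_zero_right)
  show ?thesis
    by (rule Lim_null_comparison[OF eventually_mono[OF eventually_gt_at_top[of 0] bound] lim])
qed

lemma sum_inverse_asymptotic:
  assumes z: "z \<notin> \<real>\<^sub>\<le>\<^sub>0"
  shows "(\<lambda>N. \<Sum>k<N. 1 / (of_nat (Suc k) * z + of_nat N)) \<longlonglongrightarrow> Ln (1 + z) / z"
proof -
  obtain c where c: "c > 0"
    and cell: "\<And>N k v. N > 0 \<Longrightarrow> v \<in> closed_segment (of_nat k * z + of_nat N) (of_nat (Suc k) * z + of_nat N) \<Longrightarrow>
           v \<notin> \<real>\<^sub>\<le>\<^sub>0 \<and> c * real N \<le> norm v"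
    using trapezoid_cells[OF z] by metis
  have z0: "z \<noteq> 0" "1 + z \<noteq> 0" using z one_plus_not_nonpos[OF z] by auto
  have bound: "norm ((\<Sum>k<N. 1 / (of_nat (Suc k) * z + of_nat N)) - Ln (1 + z) / z - (1 / (1 + z) - 1) / 2 * (1 / of_nat N))
          \<le> norm z ^ 2 / (2 * c ^ 3) * (1 / real N)" if N: "N > 0" for N
  proof -
    define v where "v = (\<lambda>k. of_nat k * z + of_nat N)"
    have "norm (Ln (v (Suc k)) - Ln (v k) - z / 2 * (1 / (v k) + 1 / (v (Suc k)))) \<le> norm z ^ 3 / (2 * (c * real N) ^ 3)" for k
    proof -
      have "v (Suc k) - v k = z" by (simp add: v_def algebra_simps)
      moreover have "norm (Ln (v (Suc k)) - Ln (v k)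
           - (v (Suc k) - v k) / 2 * (1 / (v k) + 1 / (v (Suc k)))) \<le> norm (v (Suc k) - v k) ^ 3 / (2 * (c * real N) ^ 3)"
        by (rule trapezoid_inverse) (use cell[OF N] c N in \<open>auto simp: v_def\<close>)
      ultimately show ?thesis by simp
    qed
    from trapezoid_sum[where v = v and F = Ln and f = "\<lambda>w. 1 / w", OF z0(1) this, of N]
    have "norm ((\<Sum>k<N. 1 / (v (Suc k))) - (Ln (v N) - Ln (v 0)) / z - (1 / (v N) - 1 / (v 0)) / 2)
            \<le> real N * (norm z ^ 3 / (2 * (c * real N) ^ 3)) / norm z" .
    also have "\<dots> = norm z ^ 2 / (2 * c ^ 3) * (1 / (real N * real N))"
      using z0 c N by (simp add: field_simps power2_eq_square power3_eq_cube)
    also have "\<dots> \<le> norm z ^ 2 / (2 * c ^ 3) * (1 / (real N * 1))"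
      using c N by (intro mult_left_mono divide_left_mono) auto
    also have "v 0 = of_nat N" by (simp add: v_def)
    also have "v N = of_nat N * (1 + z)" by (simp add: v_def algebra_simps)
    also have "Ln (of_nat N * (1 + z)) = of_real (ln (real N)) + Ln (1 + z)"
      using N z0 by (simp add: Ln_of_nat_mult)
    also have "Ln (of_nat N) = of_real (ln (real N))" using N by simp
    also have "1 / (of_nat N * (1 + z)) - 1 / of_nat N = (1 / (1 + z) - 1) * (1 / of_nat N)"
      using N z0 by (simp add: diff_divide_distrib)
    finally show ?thesis by (simp add: v_def mult_ac del: of_nat_Suc)
  qed
  have "(\<lambda>N. norm z ^ 2 / (2 * c ^ 3) * (1 / real N)) \<longlonglongrightarrow> norm z ^ 2 / (2 * c ^ 3) * 0"
    by (intro tendsto_mult_left lim_1_over_n)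
  hence lim: "(\<lambda>N. norm z ^ 2 / (2 * c ^ 3) * (1 / real N)) \<longlonglongrightarrow> 0" by (simp only: mult_zero_right)
  have "(\<lambda>N. (\<Sum>k<N. 1 / (of_nat (Suc k) * z + of_nat N)) - Ln (1 + z) / z - (1 / (1 + z) - 1) / 2 * (1 / of_nat N)) \<longlonglongrightarrow> 0"
    by (rule Lim_null_comparison[OF eventually_mono[OF eventually_gt_at_top[of 0] bound] lim])
  moreover have "(\<lambda>N. (1 / (1 + z) - 1) / 2 * (1 / of_nat N)) \<longlonglongrightarrow> (1 / (1 + z) - 1) / 2 * 0"
    by (intro tendsto_mult_left lim_1_over_n)
  ultimately have "(\<lambda>N. ((\<Sum>k<N. 1 / (of_nat (Suc k) * z + of_nat N)) - Ln (1 + z) / z - (1 / (1 + z) - 1) / 2 * (1 / of_nat N))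
      + (1 / (1 + z) - 1) / 2 * (1 / of_nat N) + Ln (1 + z) / z) \<longlonglongrightarrow> 0 + (1 / (1 + z) - 1) / 2 * 0 + Ln (1 + z) / z"
    by (intro tendsto_add tendsto_const)
  thus ?thesis by simp
qed

text \<open>
  Square boxes are used because they are invariant under exchanging the two coordinates.
\<close>
definition box_sum :: "nat \<Rightarrow> complex \<Rightarrow> complex" where
  "box_sum N z = (\<Sum>k<N. \<Sum>j<N. lattice_term z (k, j))"

lemma box_sum_tendsto:
  assumes z: "z \<notin> \<real>\<^sub>\<le>\<^sub>0"
  shows "(\<lambda>N. box_sum N z) \<longlonglongrightarrow> digamma_sum z"
proof -
  have "(sum (lattice_term z) \<longlongrightarrow> digamma_sum z) (finite_subsets_at_top UNIV)"
    using lattice_term_has_sum[OF z] by (simp add: has_sum_def)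
  moreover have "filterlim (\<lambda>N. {..<N} \<times> {..<N} :: (nat \<times> nat) set) (finite_subsets_at_top UNIV) sequentially"
    unfolding filterlim_finite_subsets_at_top
  proof (intro allI impI)
    fix X :: "(nat \<times> nat) set" assume "finite X \<and> X \<subseteq> UNIV"
    hence X: "finite X" by auto
    define m where "m = Suc (Max (insert 0 (fst ` X \<union> snd ` X)))"
    have "X \<subseteq> {..<N} \<times> {..<N}" if "N \<ge> m" for N
    proof
      fix p assume p: "p \<in> X"
      have "fst p \<le> Max (insert 0 (fst ` X \<union> snd ` X))" "snd p \<le> Max (insert 0 (fst ` X \<union> snd ` X))"
        using X p by (auto intro!: Max_ge)
      thus "p \<in> {..<N} \<times> {..<N}" using that by (cases p) (auto simp: m_def)
    qed
    thus "\<forall>\<^sub>F N in sequentially. finite ({..<N} \<times> {..<N} :: (nat \<times> nat) set) \<and> X \<subseteq> {..<N} \<times> {..<N} \<and> {..<N} \<times> {..<N} \<subseteq> UNIV"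
      by (auto intro!: eventually_mono[OF eventually_ge_at_top[of m]])
  qed
  ultimately have "(\<lambda>N. sum (lattice_term z) ({..<N} \<times> {..<N})) \<longlonglongrightarrow> digamma_sum z"
    by (rule filterlim_compose)
  thus ?thesis by (simp add: box_sum_def sum.cartesian_product case_prod_unfold)
qed

text \<open>
  Only the last double sum is not explicit, and it is the one that is symmetric in the two indices.
\<close>
lemma box_sum_eq:
  assumes z: "z \<notin> \<real>\<^sub>\<le>\<^sub>0"
  shows "box_sum N z = (\<Sum>k<N. Ln (of_nat (Suc k) * z + of_nat N)) - of_nat N * Ln z - of_real (ln (fact N))
           - of_real (harm N) / (2 * z) + (\<Sum>k<N. 1 / (of_nat (Suc k) * z + of_nat N)) / 2
           - (\<Sum>k<N. \<Sum>j<N. 1 / (of_nat (Suc k) * z + of_nat (Suc j)))"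
proof -
  have z0: "z \<noteq> 0" using z by auto
  have row: "(\<Sum>j<N. lattice_term z (k, j)) =
      Ln (of_nat (Suc k) * z + of_nat N) - of_real (ln (real (Suc k))) - Ln z
      - inverse (of_nat (Suc k)) / (2 * z) + 1 / (of_nat (Suc k) * z + of_nat N) / 2
      - (\<Sum>j<N. 1 / (of_nat (Suc k) * z + of_nat (Suc j)))" for k
  proof -
    define w where "w = of_nat (Suc k) * z"
    have shift: "(\<Sum>j<N. 1 / (w + of_nat j)) = (\<Sum>j<N. 1 / (w + of_nat (Suc j))) + 1 / w - 1 / (w + of_nat N)"
      by (induction N) (auto simp: add_ac)
    have 1: "Ln w = of_real (ln (real (Suc k))) + Ln z" unfolding w_def using z0 by (intro Ln_of_nat_mult) auto
    have 2: "1 / w / 2 = inverse (of_nat (Suc k)) / (2 * z)"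
      unfolding w_def using z0 by (simp add: field_simps del: of_nat_Suc)
    have "(\<Sum>j<N. lattice_term z (k, j)) = (\<Sum>j<N. trap_err (w + of_nat j))"
      by (simp add: lattice_term_def w_def)
    also have "\<dots> = Ln (w + of_nat N) - Ln w - 1 / w / 2 + 1 / (w + of_nat N) / 2 - (\<Sum>j<N. 1 / (w + of_nat (Suc j)))"
    proof -
      define P P' where "P = 1 / (w + of_nat N)" and "P' = 1 / w"
      show ?thesis
        unfolding trap_err_partial_sum shift P_def[symmetric] P'_def[symmetric] by (simp add: field_simps)
    qed
    finally show ?thesis unfolding 1 2 unfolding w_def by (simp add: algebra_simps del: of_nat_Suc)
  qed
  have lnfact: "(\<Sum>k<N. of_real (ln (real (Suc k)))) = complex_of_real (ln (fact N))"
    by (induction N) (auto simp: ln_mult simp flip: of_real_add of_nat_Suc)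
  have harm: "(\<Sum>k<N. inverse (of_nat (Suc k))) = complex_of_real (harm N)"
    by (induction N) (simp_all add: harm_expand(1) harm_Suc del: of_nat_Suc)
  show ?thesis
    unfolding box_sum_def row sum.distrib sum_subtractf lnfact sum_divide_distrib[symmetric] harm
    by (simp del: of_nat_Suc)
qed

text \<open>
  The substitution \<open>z \<mapsto> 1 / z\<close> exchanges the two coordinates up to the factor \<open>z\<close>. This is the source of the
  functional equation.
\<close>
lemma double_sum_inverse_symmetric:
  assumes z: "z \<noteq> 0"
  shows "(\<Sum>k<N. \<Sum>j<N. 1 / (of_nat (Suc k) * (1 / z) + of_nat (Suc j))) / z
         = (\<Sum>k<N. \<Sum>j<N. 1 / (of_nat (Suc k) * z + of_nat (Suc j)) :: complex)"
proof -
  have "1 / (of_nat (Suc k) * (1 / z) + of_nat (Suc j)) / z = 1 / (of_nat (Suc j) * z + of_nat (Suc k))" for k j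
    unfolding divide_divide_eq_left using z by (simp add: distrib_right add.commute del: of_nat_Suc)
  hence "(\<Sum>k<N. \<Sum>j<N. 1 / (of_nat (Suc k) * (1 / z) + of_nat (Suc j))) / z
       = (\<Sum>k<N. \<Sum>j<N. 1 / (of_nat (Suc j) * z + of_nat (Suc k)))"
    by (simp add: sum_divide_distrib del: of_nat_Suc)
  also have "\<dots> = (\<Sum>k<N. \<Sum>j<N. 1 / (of_nat (Suc k) * z + of_nat (Suc j)))"
    by (rule sum.swap)
  finally show ?thesis .
qed

section \<open>The inversion formula\<close>

text \<open>
  The arguments of \<open>z\<close> and \<open>1 + z\<close> lie on the same side of the real axis, so their difference stays in the
  range of the principal branch.
\<close>
lemma Ln_one_plus_inverse:
  assumes z: "z \<notin> \<real>\<^sub>\<le>\<^sub>0"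
  shows "Ln (1 + 1 / z) = Ln (1 + z) - Ln z"
proof -
  have z0: "z \<noteq> 0" "1 + z \<noteq> 0" using z one_plus_not_nonpos[OF z] by auto
  have eq: "1 + 1 / z = (1 + z) / z" using z0 by (simp add: field_simps)
  consider "Im z > 0" | "Im z < 0" | "Im z = 0" by linarith
  hence "\<bar>Im (Ln (1 + z)) - Im (Ln z)\<bar> < pi"
  proof cases
    case 1
    have "Im (Ln z) < pi" "0 < Im (Ln z)" "Im (Ln (1+z)) < pi" "0 < Im (Ln (1+z))"
      using 1 z0 Im_Ln_pos_lt_imp[of z] Im_Ln_pos_lt_imp[of "1+z"] by auto
    thus ?thesis by auto
  next
    case 2
    have "Im (Ln z) < 0" "Im (Ln (1+z)) < 0"
      using 2 z0 Im_Ln_pos_le[of z] Im_Ln_pos_le[of "1+z"] Im_Ln_le_pi[of z] Im_Ln_le_pi[of "1+z"] by auto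
    moreover have "- pi < Im (Ln z)" "- pi < Im (Ln (1+z))" using z0 mpi_less_Im_Ln by auto
    ultimately show ?thesis by auto
  next
    case 3
    hence "Re z > 0" using z by (auto simp: complex_nonpos_Reals_iff)
    hence "Im (Ln z) = 0" "Im (Ln (1 + z)) = 0" using 3 z0 by (auto simp: Im_Ln_eq_0)
    thus ?thesis by simp
  qed
  hence "Ln ((1 + z) / z) = Ln (1 + z) - Ln z"
    using z0 by (intro Ln_unique) (auto simp: exp_diff)
  thus ?thesis by (simp add: eq)
qed

lemma one_over_not_nonpos: "z \<notin> \<real>\<^sub>\<le>\<^sub>0 \<Longrightarrow> 1 / z \<notin> \<real>\<^sub>\<le>\<^sub>0" for z :: complex
  by (metis inverse_eq_divide inverse_inverse_eq inverse_nonpositive_iff_nonpositive nonpos_Reals_inverse_iff)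

text \<open>
  All terms of the box sums that do not involve the logarithm of \<open>z\<close> or \<open>1 + z\<close> combine into this real
  sequence, which occurs with the factor \<open>1 - 1 / z\<close>.
\<close>
definition stirling_seq :: "nat \<Rightarrow> real" where
  "stirling_seq N = real N * ln (real N) - real N - ln (fact N) + harm N / 2"

text \<open>
  In the difference the symmetric double sums cancel, and so do all terms that grow with \<open>N\<close>, except
  for those in \<^const>\<open>stirling_seq\<close>.
\<close>
lemma box_sum_inversion_defect:
  assumes z: "z \<notin> \<real>\<^sub>\<le>\<^sub>0"
  shows "(\<lambda>N. box_sum N z - box_sum N (1 / z) / z - (1 - 1 / z) * of_real (stirling_seq N))
            \<longlonglongrightarrow> (1 + 1 / z) * Ln z / 2"
proof -
  have z0: "z \<noteq> 0" "1 + z \<noteq> 0" using z one_plus_not_nonpos[OF z] by auto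
  note z' = one_over_not_nonpos[OF z]
  define e where "e = (\<lambda>y N. (\<Sum>k<N. Ln (of_nat (Suc k) * y + of_nat N))
            - (of_real (real N * ln (real N) - real N) + of_nat N * (1 + 1 / y) * Ln (1 + y) + Ln (1 + y) / 2))"
  define b where "b = (\<lambda>y N. \<Sum>k<N. 1 / (of_nat (Suc k) * y + of_nat N) :: complex)"
  have e: "e z \<longlonglongrightarrow> 0" "e (1 / z) \<longlonglongrightarrow> 0"
    using sum_Ln_asymptotic[OF z] sum_Ln_asymptotic[OF z'] by (simp_all add: e_def)
  have b: "b z \<longlonglongrightarrow> Ln (1 + z) / z" "b (1 / z) \<longlonglongrightarrow> Ln (1 + 1 / z) / (1 / z)"
    using sum_inverse_asymptotic[OF z] sum_inverse_asymptotic[OF z'] by (simp_all only: b_def)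
  have Lninv: "Ln (1 / z) = - Ln z" using Ln_inverse[OF z] by (simp add: inverse_eq_divide)
  have eq: "box_sum N z - box_sum N (1 / z) / z - (1 - 1 / z) * of_real (stirling_seq N)
     = e z N - e (1 / z) N / z + b z N / 2 - b (1 / z) N / (2 * z)
       + (1 - 1 / z) * Ln (1 + z) / 2 + Ln z / (2 * z)" for N
  proof -
    define D where "D = (\<Sum>k<N. \<Sum>j<N. 1 / (of_nat (Suc k) * z + of_nat (Suc j)))"
    define D' where "D' = (\<Sum>k<N. \<Sum>j<N. 1 / (of_nat (Suc k) * (1 / z) + of_nat (Suc j)))"
    have "D' / z = D" using double_sum_inverse_symmetric[OF z0(1)] by (simp only: D_def D'_def)
    hence D: "D' = z * D" using z0 by (simp add: field_simps)
    define X l H F where "X = Ln (1 + z)" and "l = Ln z" and "H = complex_of_real (harm N)" and "F = complex_of_real (ln (fact N))"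
    define M where "M = complex_of_real (ln (real N))"
    have 1: "(\<Sum>k<N. Ln (of_nat (Suc k) * y + of_nat N)) = e y N + (of_real (real N * ln (real N) - real N) + of_nat N * (1 + 1 / y) * Ln (1 + y) + Ln (1 + y) / 2)" for y
      by (simp add: e_def)
    have 2: "(\<Sum>k<N. 1 / (of_nat (Suc k) * y + of_nat N)) = b y N" for y
      by (simp add: b_def)
    have A: "box_sum N z = e z N + (of_nat N * M - of_nat N + of_nat N * (1 + 1 / z) * X + X / 2)
        - of_nat N * l - F - H / (2 * z) + b z N / 2 - D"
      unfolding box_sum_eq[OF z] 1 2 D_def[symmetric] by (simp add: X_def l_def H_def F_def M_def)
    have B: "box_sum N (1 / z) = e (1 / z) N + (of_nat N * M - of_nat N + of_nat N * (1 + z) * (X - l) + (X - l) / 2)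
        + of_nat N * l - F - H * z / 2 + b (1 / z) N / 2 - z * D"
      unfolding box_sum_eq[OF z'] 1 2 D'_def[symmetric] D Lninv Ln_one_plus_inverse[OF z]
      by (simp add: X_def l_def H_def F_def M_def)
    have C: "of_real (stirling_seq N) = of_nat N * M - of_nat N - F + H / 2"
      by (simp add: stirling_seq_def H_def F_def M_def)
    show ?thesis unfolding A B C X_def[symmetric] l_def[symmetric] using z0(1)
      by (simp add: field_simps)
  qed
  have "(\<lambda>N. e z N - e (1 / z) N / z + b z N / 2 - b (1 / z) N / (2 * z)
       + (1 - 1 / z) * Ln (1 + z) / 2 + Ln z / (2 * z))
     \<longlonglongrightarrow> 0 - 0 / z + (Ln (1 + z) / z) / 2 - (Ln (1 + 1 / z) / (1 / z)) / (2 * z) + (1 - 1 / z) * Ln (1 + z) / 2 + Ln z / (2 * z)"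
    by (intro tendsto_intros e b) (use z0 in auto)
  also have "0 - 0 / z + (Ln (1 + z) / z) / 2 - (Ln (1 + 1 / z) / (1 / z)) / (2 * z) + (1 - 1 / z) * Ln (1 + z) / 2 + Ln z / (2 * z)
      = (1 + 1 / z) * Ln z / 2"
    unfolding Ln_one_plus_inverse[OF z] using z0(1) by (simp add: field_simps)
  finally show ?thesis unfolding eq .
qed

text \<open>
  The combination is the logarithm of a central binomial coefficient, that is, of \<open>(-1/2) gchoose n\<close> up to elementary
  factors; the asymptotics of the latter bring in \<open>\<Gamma>(1/2) = \<surd>\<pi>\<close>.
\<close>
lemma stirling_seq_LIMSEQ_log_pi:
  defines "s \<equiv> \<lambda>n. real n * ln (real n) - real n - ln (fact n) + ln (real n) / 2"
  shows "(\<lambda>n. 2 * s n - s (2 * n)) \<longlonglongrightarrow> - ln (2 * pi) / 2"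
proof -
  define t where "t = (\<lambda>n. (- (1/2) gchoose n) / ((-1)^n / exp ((- (1/2) + 1) * of_real (ln (real n)))) :: real)"
  have t: "t \<longlonglongrightarrow> inverse (sqrt pi)"
    using gbinomial_asymptotic[of "- (1/2) :: real"] by (simp add: t_def Gamma_one_half_real)
  have "inverse (sqrt pi) \<noteq> 0" by simp
  from tendsto_ln[OF t this] have "(\<lambda>n. ln (t n)) \<longlonglongrightarrow> ln (inverse (sqrt pi))" .
  hence "(\<lambda>n. ln (t n) - ln 2 / 2) \<longlonglongrightarrow> ln (inverse (sqrt pi)) - ln 2 / 2"
    by (rule tendsto_diff[OF _ tendsto_const])
  also have "ln (inverse (sqrt pi)) - ln 2 / 2 = - ln (2 * pi) / 2"
    by (simp add: ln_inverse ln_div ln_sqrt ln_mult field_simps)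
  finally have lim: "(\<lambda>n. ln (t n) - ln 2 / 2) \<longlonglongrightarrow> - ln (2 * pi) / 2" .
  have eq: "ln (t n) - ln 2 / 2 = 2 * s n - s (2 * n)" if n: "n > 0" for n
  proof -
    have "t n = pochhammer (1/2) n / fact n * exp (ln (real n) / 2)"
      by (simp add: t_def gbinomial_pochhammer)
    also have "pochhammer (1/2) n = fact (2 * n) / (2 ^ (2 * n) * fact n :: real)"
      using fact_double[of n, where 'a = real] by (simp add: field_simps)
    finally have tn: "t n = fact (2 * n) / (2 ^ (2 * n) * fact n) / fact n * exp (ln (real n) / 2)" .
    have "ln (t n) = ln (fact (2 * n)) - 2 * real n * ln 2 - 2 * ln (fact n) + ln (real n) / 2"
      unfolding tn by (simp add: ln_mult ln_div ln_realpow)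
    moreover have "ln (real (2 * n)) = ln 2 + ln (real n)" using n by (simp add: ln_mult)
    ultimately show ?thesis using n by (simp add: s_def field_simps)
  qed
  show ?thesis
    by (rule Lim_transform_eventually[OF lim eventually_mono[OF eventually_gt_at_top[of 0] eq]])
qed

text \<open>
  Convergence comes for free from the inversion formula itself, applied at \<open>z = 2\<close>, since the box sums
  converge. Once the limit exists, doubling the index determines it.
\<close>
lemma stirling_seq_LIMSEQ:
  "stirling_seq \<longlonglongrightarrow> (euler_mascheroni - ln (2 * pi)) / 2"
proof -
  have "(2::complex) \<notin> \<real>\<^sub>\<le>\<^sub>0" by (simp add: complex_nonpos_Reals_iff)
  note two = this one_over_not_nonpos[OF this]
  define d where "d = (\<lambda>N. box_sum N 2 - box_sum N (1 / 2) / 2 - (1 - 1 / 2) * of_real (stirling_seq N))"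
  \<comment> \<open>The factor \<open>1 - 1 / z\<close> equals \<open>1 / 2\<close> here, so the sequence can be solved for.\<close>
  have "(\<lambda>N. Re (2 * (box_sum N 2 - box_sum N (1 / 2) / 2 - d N))) \<longlonglongrightarrow> 
           Re (2 * (digamma_sum 2 - digamma_sum (1 / 2) / 2 - (1 + 1 / 2) * Ln 2 / 2))"
    unfolding d_def by (intro tendsto_intros box_sum_tendsto two box_sum_inversion_defect) auto
  moreover have "Re (2 * (box_sum N 2 - box_sum N (1 / 2) / 2 - d N)) = stirling_seq N" for N
    by (simp add: d_def)
  ultimately obtain \<kappa> where \<kappa>: "stirling_seq \<longlonglongrightarrow> \<kappa>" by auto
  define s where "s = (\<lambda>n. real n * ln (real n) - real n - ln (fact n) + ln (real n) / 2)"
  have "(\<lambda>n. stirling_seq n - (harm n - ln (real n)) / 2) \<longlonglongrightarrow> \<kappa> - euler_mascheroni / 2"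
    by (intro tendsto_intros \<kappa> euler_mascheroni_LIMSEQ) auto
  also have "(\<lambda>n. stirling_seq n - (harm n - ln (real n)) / 2) = s"
    by (simp add: fun_eq_iff s_def stirling_seq_def field_simps)
  finally have s: "s \<longlonglongrightarrow> \<kappa> - euler_mascheroni / 2" .
  have "filterlim (\<lambda>n::nat. 2 * n) at_top at_top" 
    by (rule filterlim_subseq) (auto simp: strict_mono_def)
  from filterlim_compose[OF s this] have "(\<lambda>n. s (2 * n)) \<longlonglongrightarrow> \<kappa> - euler_mascheroni / 2" .
  hence "(\<lambda>n. 2 * s n - s (2 * n)) \<longlonglongrightarrow> 2 * (\<kappa> - euler_mascheroni / 2) - (\<kappa> - euler_mascheroni / 2)"
    by (intro tendsto_intros s)
  with stirling_seq_LIMSEQ_log_pi have "- ln (2 * pi) / 2 = 2 * (\<kappa> - euler_mascheroni / 2) - (\<kappa> - euler_mascheroni / 2)"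
    unfolding s_def by (rule LIMSEQ_unique)
  hence "\<kappa> = (euler_mascheroni - ln (2 * pi)) / 2" by (simp add: field_simps)
  with \<kappa> show ?thesis by (simp only:)
qed

lemma log_correction_eq:
  assumes z: "z \<notin> \<real>\<^sub>\<le>\<^sub>0"
  shows "log_correction z = (euler_mascheroni - of_real (ln (2 * pi)) + Ln z) / 2"
proof -
  have z0: "z \<noteq> 0" using z by auto
  have "2 * of_real pi / z = of_real (2 * pi) * inverse z" by (simp add: divide_inverse)
  also have "Ln \<dots> = of_real (ln (2 * pi)) + Ln (inverse z)"
    using z0 Ln_times_of_real[of "2 * pi" "inverse z"] Ln_of_real[of "2 * pi"] by (simp del: of_real_mult)
  finally show ?thesis unfolding log_correction_def using Ln_inverse[OF z] by (simp add: algebra_simps)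
qed

text \<open>
  Guinand's transformation formula: the constants \<open>\<gamma>\<close> and \<open>log (2 * \<pi> / z)\<close> in \<^const>\<open>F1\<close> are what is left
  of the inversion defect of the box sums.
\<close>
lemma F1_inversion:
  assumes z: "z \<notin> \<real>\<^sub>\<le>\<^sub>0"
  shows "F1 z = F1 (1 / z) / z"
proof -
  have z0: "z \<noteq> 0" using z by auto
  note z' = one_over_not_nonpos[OF z]
  define c where "c = complex_of_real ((euler_mascheroni - ln (2 * pi)) / 2)"
  have "(\<lambda>N. box_sum N z - box_sum N (1 / z) / z - (1 - 1 / z) * of_real (stirling_seq N))
     \<longlonglongrightarrow> digamma_sum z - digamma_sum (1 / z) / z - (1 - 1 / z) * c"
    unfolding c_def by (intro tendsto_intros box_sum_tendsto z z' stirling_seq_LIMSEQ z0)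
  from LIMSEQ_unique[OF this box_sum_inversion_defect[OF z]]
  have sum_inv: "digamma_sum z = digamma_sum (1 / z) / z + (1 - 1 / z) * c + (1 + 1 / z) * Ln z / 2"
    by (simp only: diff_eq_eq add_ac)
  have A: "log_correction w = c + Ln w / 2" if "w \<notin> \<real>\<^sub>\<le>\<^sub>0" for w
    unfolding log_correction_eq[OF that] c_def by (simp add: add_divide_distrib)
  have Lninv: "Ln (1 / z) = - Ln z" using Ln_inverse[OF z] by (simp add: inverse_eq_divide)
  have "P / z + (1 - 1 / z) * c + (1 + 1 / z) * l / 2 - (c + l / 2) = (P - (c + - l / 2)) / z" for P l
    using z0 by (simp add: field_simps)
  thus ?thesis
    unfolding F1_eq[OF z] F1_eq[OF z'] A[OF z] A[OF z'] sum_inv Lninv .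
qed

section \<open>A Lambert series with period function F1\<close>

text \<open>
  Differentiating the reflection formula for the reciprocal of the Gamma function.
\<close>
lemma Digamma_reflection:
  fixes w :: complex
  assumes w: "w \<notin> \<int>"
  shows "Digamma (1 - w) - Digamma w = of_real pi * cot (of_real pi * w)"
proof -
  have nonpos: "w \<notin> \<int>\<^sub>\<le>\<^sub>0" "1 - w \<notin> \<int>\<^sub>\<le>\<^sub>0"
  proof -
    show "w \<notin> \<int>\<^sub>\<le>\<^sub>0" using w by auto
    have "1 - w \<in> \<int> \<Longrightarrow> w \<in> \<int>" using Ints_diff[of 1 "1 - w"] by simp
    thus "1 - w \<notin> \<int>\<^sub>\<le>\<^sub>0" using w by auto
  qed
  have "((\<lambda>w. rGamma w * rGamma (1 - w)) has_field_derivative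
          (- rGamma w * Digamma w) * rGamma (1 - w) + rGamma w * (- rGamma (1 - w) * Digamma (1 - w) * (-1))) (at w)"
    using nonpos by (auto intro!: derivative_eq_intros simp: algebra_simps)
  moreover have "((\<lambda>w. sin (of_real pi * w) / of_real pi) has_field_derivative cos (of_real pi * w)) (at w)"
    by (auto intro!: derivative_eq_intros)
  ultimately have "(- rGamma w * Digamma w) * rGamma (1 - w) + rGamma w * (- rGamma (1 - w) * Digamma (1 - w) * (-1))
      = cos (of_real pi * w)"
    unfolding rGamma_reflection_complex by (rule DERIV_unique)
  hence "(rGamma w * rGamma (1 - w)) * (Digamma (1 - w) - Digamma w) = cos (of_real pi * w)"
    by (simp add: algebra_simps)
  hence eq: "sin (of_real pi * w) / of_real pi * (Digamma (1 - w) - Digamma w) = cos (of_real pi * w)"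
    unfolding rGamma_reflection_complex .
  have "sin (of_real pi * w) / of_real pi \<noteq> 0"
    unfolding rGamma_reflection_complex[symmetric] using nonpos by (simp add: rGamma_eq_zero_iff)
  thus ?thesis using eq by (simp add: cot_def field_simps)
qed

text \<open>
  The term \<open>q / (1 - q)\<close> of a Lambert series, with \<open>q = exp (2 * \<pi> * \<i> * w)\<close>.
\<close>
definition lambert :: "complex \<Rightarrow> complex" where
  "lambert w = exp (2 * pi * \<i> * w) / (1 - exp (2 * pi * \<i> * w))"

lemma norm_exp_upper: "norm (exp (2 * of_real pi * \<i> * w)) = exp (- (2 * pi * Im w))"
  by (simp add: norm_exp_eq_Re)

lemma exp_upper_neq_1: "Im w > 0 \<Longrightarrow> exp (2 * of_real pi * \<i> * w) \<noteq> 1"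
  using norm_exp_upper[of w] by (metis exp_less_one_iff less_irrefl mult_pos_pos neg_less_0_iff_less norm_one pi_gt_zero zero_less_numeral)

lemma cot_eq_lambert:
  assumes w: "Im w > 0"
  shows "cot (of_real pi * w) = - \<i> * (1 + 2 * lambert w)"
proof -
  define E where "E = exp (\<i> * (of_real pi * w))"
  have E0: "E \<noteq> 0" by (simp add: E_def)
  have E2: "exp (2 * pi * \<i> * w) = E * E"
    unfolding E_def by (simp flip: exp_add add: algebra_simps)
  have E1: "1 - E * E \<noteq> 0" using exp_upper_neq_1[OF w] E2 by auto
  have s: "sin (of_real pi * w) = (E - inverse E) / (2 * \<i>)" "cos (of_real pi * w) = (E + inverse E) / 2"
    by (simp_all add: sin_exp_eq cos_exp_eq E_def exp_minus)
  have "E - inverse E \<noteq> 0" using E0 E1 by (simp add: field_simps)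
  thus ?thesis unfolding cot_def s lambert_def E2 using E0 E1 by (simp add: field_simps)
qed

lemma Im_pos_not_nonpos: "Im z > 0 \<Longrightarrow> z \<notin> \<real>\<^sub>\<le>\<^sub>0" "Im z > 0 \<Longrightarrow> - z \<notin> \<real>\<^sub>\<le>\<^sub>0"
  by (auto simp: complex_nonpos_Reals_iff)

lemma Ln_uminus_upper: "Im z > 0 \<Longrightarrow> Ln (- z) = Ln z - \<i> * of_real pi"
  using Ln_minus[of z] by (cases "z = 0") auto

text \<open>
  The summands of the series in \<^const>\<open>F1\<close> are even up to an exponentially small term: the branch jump
  \<open>\<i> * \<pi>\<close> of the logarithm cancels the limit of the cotangent.
\<close>
lemma digamma_term_reflection:
  assumes w: "Im w > 0"
  shows "(Digamma w + 1 / (2 * w) - Ln w) - (Digamma (- w) + 1 / (2 * (- w)) - Ln (- w)) = 2 * pi * \<i> * lambert w"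
proof -
  have w0: "w \<noteq> 0" using w by auto
  have "w \<notin> \<int>" using w by (auto elim!: Ints_cases)
  from Digamma_reflection[OF this]
  have 1: "Digamma (1 - w) = Digamma w + of_real pi * (- \<i> * (1 + 2 * lambert w))"
    unfolding cot_eq_lambert[OF w] by (simp add: algebra_simps)
  have 2: "Digamma (1 - w) = Digamma (- w) - 1 / w"
    using Digamma_plus1[of "- w"] w0 by simp
  have 3: "Digamma (- w) = Digamma w + of_real pi * (- \<i> * (1 + 2 * lambert w)) + 1 / w"
    using 1 2 by (simp add: algebra_simps)
  show ?thesis unfolding 3 Ln_uminus_upper[OF w] using w0 by (simp add: field_simps)
qed

lemma lambert_has_sum:
  assumes z: "Im z > 0"
  shows "((\<lambda>k. lambert (of_nat k * z)) has_sum (digamma_sum z - digamma_sum (- z)) / (2 * pi * \<i>)) {0<..}"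
proof -
  define r where "r = exp (- (2 * pi * Im z))"
  have r: "0 < r" "r < 1" using z by (auto simp: r_def)
  have "(\<lambda>k. lambert (of_nat (Suc k) * z)) sums ((digamma_sum z - digamma_sum (- z)) / (2 * pi * \<i>))"
  proof -
    have "2 * pi * \<i> * lambert (of_nat (Suc k) * z) =
      (Digamma (of_nat (Suc k) * z) + 1 / (2 * of_nat (Suc k) * z) - Ln (of_nat (Suc k) * z))
      - (Digamma (of_nat (Suc k) * (- z)) + 1 / (2 * of_nat (Suc k) * (- z)) - Ln (of_nat (Suc k) * (- z)))" for k
      using digamma_term_reflection[of "of_nat (Suc k) * z"] z by (simp add: mult.assoc del: of_nat_Suc)
    hence "(\<lambda>k. 2 * pi * \<i> * lambert (of_nat (Suc k) * z)) sums (digamma_sum z - digamma_sum (- z))"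
      using sums_diff[OF digamma_terms_sums[OF Im_pos_not_nonpos(1)[OF z]] digamma_terms_sums[OF Im_pos_not_nonpos(2)[OF z]]]
      by simp
    from sums_divide[OF this, of "2 * pi * \<i>"] show ?thesis by simp
  qed
  moreover have "summable (\<lambda>k. norm (lambert (of_nat (Suc k) * z)))"
  proof (rule summable_comparison_test')
    show "summable (\<lambda>k. r ^ k * (r / (1 - r)))"
      using r by (intro summable_mult2 summable_geometric) auto
    fix k :: nat
    let ?e = "exp (2 * of_real pi * \<i> * (of_nat (Suc k) * z))"
    have ne: "norm ?e = r ^ Suc k"
    proof -
      have "r ^ Suc k = exp (of_nat (Suc k) * (- (2 * pi * Im z)))"
        unfolding r_def by (rule exp_of_nat_mult[symmetric])
      thus ?thesis unfolding norm_exp_upper by (simp add: algebra_simps)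
    qed
    have "1 - r \<le> 1 - r ^ Suc k" using r power_le_one[of r k] by (simp add: mult_left_le)
    also have "\<dots> \<le> norm (1 - ?e)" using norm_triangle_ineq2[of 1 ?e] unfolding ne by simp
    finally have "norm ?e / norm (1 - ?e) \<le> r ^ Suc k / (1 - r)"
      using r unfolding ne by (intro divide_left_mono mult_pos_pos) auto
    thus "norm (norm (lambert (of_nat (Suc k) * z))) \<le> r ^ k * (r / (1 - r))"
      by (simp add: lambert_def norm_divide mult_ac)
  qed
  ultimately have "((\<lambda>k. lambert (of_nat (Suc k) * z)) has_sum (digamma_sum z - digamma_sum (- z)) / (2 * pi * \<i>)) UNIV"
    by (intro norm_summable_imp_has_sum)
  also have "?this \<longleftrightarrow> ((\<lambda>k. lambert (of_nat k * z)) has_sum (digamma_sum z - digamma_sum (- z)) / (2 * pi * \<i>)) {0<..}"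
    by (rule has_sum_reindex_bij_witness[of _ "\<lambda>k. k - 1" Suc]) auto
  finally show ?thesis .
qed

text \<open>
  The series is \<open>\<Sum> d(m) * q ^ m\<close>. The constant \<open>- 1/4\<close> absorbs the difference of the logarithmic corrections of
  \<^const>\<open>F1\<close> at \<open>z\<close> and \<open>- z\<close>.
\<close>
definition eis :: "complex \<Rightarrow> complex" where
  "eis z = (\<Sum>\<^sub>\<infinity>k\<in>{0<..}. lambert (of_nat k * z)) - 1 / 4"

lemma eis_has_sum:
  assumes z: "Im z > 0"
  shows "((\<lambda>k. lambert (of_nat k * z)) has_sum (eis z + 1 / 4)) {0<..}"
  using lambert_has_sum[OF z] by (simp add: eis_def infsumI)

lemma eis_eq_F1:
  assumes z: "Im z > 0"
  shows "eis z = (F1 z - F1 (- z)) / (2 * pi * \<i>)"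
proof -
  note z' = Im_pos_not_nonpos[OF z]
  have "eis z = (digamma_sum z - digamma_sum (- z)) / (2 * pi * \<i>) - 1 / 4"
    unfolding eis_def infsumI[OF lambert_has_sum[OF z]] ..
  moreover have "log_correction z = log_correction (- z) + \<i> * of_real pi / 2"
    unfolding log_correction_eq[OF z'(1)] log_correction_eq[OF z'(2)] Ln_uminus_upper[OF z] by (simp add: field_simps)
  ultimately show ?thesis
    unfolding F1_eq[OF z'(1)] F1_eq[OF z'(2)] by (simp only:) (simp add: field_simps)
qed

text \<open>
  \<^const>\<open>F1\<close> is the period function of \<^const>\<open>eis\<close>. The inversion formula holds at both \<open>z\<close> and \<open>- z\<close>,
  and \<^const>\<open>eis\<close> is a multiple of the odd part of \<^const>\<open>F1\<close>; in the difference the values at \<open>- z\<close> cancel.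
\<close>
lemma F1_eq_eis:
  assumes z: "Im z > 0"
  shows "F1 z = pi * \<i> * (eis z - eis (- 1 / z) / z)"
proof -
  have z0: "z \<noteq> 0" using z by auto
  have "Im (- 1 / z) > 0" using z z0 by (simp add: Im_divide sum_power2_gt_zero_iff complex_eq_iff)
  from eis_eq_F1[OF this] have "eis (- 1 / z) = (F1 (1 / (- z)) - F1 (1 / z)) / (2 * pi * \<i>)" by simp
  also have "F1 (1 / z) = z * F1 z"
    using F1_inversion[OF Im_pos_not_nonpos(1)[OF z]] z0 by simp
  also have "F1 (1 / (- z)) = - z * F1 (- z)"
    using F1_inversion[OF Im_pos_not_nonpos(2)[OF z]] z0 by simp
  finally have inv: "eis (- 1 / z) = (- z * F1 (- z) - z * F1 z) / (2 * pi * \<i>)" .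
  show ?thesis unfolding eis_eq_F1[OF z] inv using z0 by (simp add: field_simps)
qed

section \<open>Hecke eigenvalue of the Lambert series\<close>

text \<open>
  With \<open>d' = d / gcd k d\<close>, all \<open>d\<close> numbers \<open>x b\<close> have the same \<open>d'\<close>-th power \<open>Q\<close>, so \<open>1 / (1 - x b)\<close> is a finite
  geometric sum over \<open>1 - Q\<close>. Summing over \<open>b\<close> leaves only the constant term, by orthogonality of roots
  of unity.
\<close>
lemma lambert_distribution:
  assumes w: "Im w > 0" and k: "k > 0" and d: "d > 0"
  shows "(\<Sum>b<d. lambert (of_nat k * ((w + of_nat b) / of_nat d))) = of_nat d * lambert (of_nat (k div gcd k d) * w)"
proof -
  define e k' d' where "e = gcd k d" and "k' = k div gcd k d" and "d' = d div gcd k d"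
  have e: "e > 0" "k = e * k'" "d = e * d'" using k d by (auto simp: e_def k'_def d'_def)
  have k': "k' > 0" "d' > 0" using e k d by (auto intro!: Nat.gr0I)
  have cop: "coprime k' d'" unfolding k'_def d'_def using d by (intro div_gcd_coprime) auto
  define x where "x = (\<lambda>b. exp (2 * of_real pi * \<i> * (of_nat k * ((w + of_nat b) / of_nat d))))"
  define Q where "Q = exp (2 * of_real pi * \<i> * (of_nat k' * w))"
  have Q1: "Q \<noteq> 1" unfolding Q_def by (rule exp_upper_neq_1) (use w k' in simp)
  have x1: "x b \<noteq> 1" for b unfolding x_def by (rule exp_upper_neq_1) (use w k d in simp)
  have xd: "x b ^ d' = Q" for b
  proof -
    have "x b ^ d' = exp (of_nat d' * (2 * of_real pi * \<i> * (of_nat k * ((w + of_nat b) / of_nat d))))"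
      unfolding x_def by (rule exp_of_nat_mult[symmetric])
    also have "of_nat d' * (2 * of_real pi * \<i> * (of_nat k * ((w + of_nat b) / of_nat d)))
        = 2 * of_real pi * \<i> * (of_nat k' * w) + 2 * of_nat (k' * b) * of_real pi * \<i>"
      using e k' by (simp add: field_simps)
    also have "exp \<dots> = Q" unfolding Q_def exp_add using exp_integer_2pi[of "of_nat (k' * b)"] by simp
    finally show ?thesis .
  qed
  have inv: "1 / (1 - x b) = (\<Sum>m<d'. x b ^ m) / (1 - Q)" for b
    using one_diff_power_eq[of "x b" d'] x1[of b] Q1 unfolding xd by (simp add: field_simps)
  have char: "(\<Sum>b<d. x b ^ m) = (if m = 0 then of_nat d else 0)" if m: "m < d'" for m
  proof (cases "m = 0")
    case False
    define c where "c = exp (2 * of_real pi * \<i> * of_nat (k * m) / of_nat d)"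
    \<comment> \<open>Otherwise \<open>d\<close> divides \<open>k * m\<close>, so \<open>d'\<close> divides \<open>m < d'\<close>.\<close>
    have "c \<noteq> 1"
    proof
      assume "c = 1"
      then obtain t :: int where "pi * (2 * (real (k * m) / real d)) = pi * (2 * of_int t)"
        unfolding c_def exp_eq_1 by (auto simp: field_simps)
      hence "real (k * m) / real d = of_int t" unfolding mult_cancel_left by auto
      hence "real_of_int (int (k * m)) = real_of_int (t * int d)" using d by (simp add: field_simps)
      hence "int (k * m) = t * int d" by (simp only: of_int_eq_iff)
      hence "int d dvd int (k * m)" by simp
      hence "d dvd k * m" by (simp only: int_dvd_int_iff)
      hence "d' dvd k' * m" using e by (simp add: mult.assoc)
      hence "d' dvd m" using cop by (simp add: coprime_dvd_mult_right_iff coprime_commute)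
      thus False using m False by (auto dest: dvd_imp_le)
    qed
    have cd: "c ^ d = 1"
    proof -
      have "c ^ d = exp (of_nat d * (2 * of_real pi * \<i> * of_nat (k * m) / of_nat d))"
        unfolding c_def by (rule exp_of_nat_mult[symmetric])
      also have "of_nat d * (2 * of_real pi * \<i> * of_nat (k * m) / of_nat d) = of_nat (k * m) * (2 * of_real pi * \<i>)"
        using d by simp
      also have "exp \<dots> = 1" unfolding exp_of_nat_mult by simp
      finally show ?thesis .
    qed
    have xb: "x b ^ m = x 0 ^ m * c ^ b" for b
      unfolding x_def c_def exp_of_nat_mult[symmetric] exp_add[symmetric]
      using d by (intro arg_cong[of _ _ exp]) (simp add: field_simps)
    have "(\<Sum>b<d. x b ^ m) = x 0 ^ m * (\<Sum>b<d. c ^ b)"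
      unfolding sum_distrib_left by (intro sum.cong refl xb)
    also have "(\<Sum>b<d. c ^ b) = 0" using \<open>c \<noteq> 1\<close> cd by (simp add: geometric_sum)
    finally show ?thesis using False by simp
  qed auto
  have "lambert (of_nat k * ((w + of_nat b) / of_nat d)) = 1 / (1 - x b) - 1" for b
  proof -
    have "lambert (of_nat k * ((w + of_nat b) / of_nat d)) = x b / (1 - x b)"
      by (simp add: lambert_def x_def)
    thus ?thesis using x1[of b] by (simp add: field_simps)
  qed
  hence "(\<Sum>b<d. lambert (of_nat k * ((w + of_nat b) / of_nat d))) = (\<Sum>b<d. 1 / (1 - x b) - 1)"
    by (simp only:)
  also have "\<dots> = (\<Sum>b<d. \<Sum>m<d'. x b ^ m) / (1 - Q) - of_nat d"
    by (simp add: sum_subtractf inv sum_divide_distrib)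
  also have "(\<Sum>b<d. \<Sum>m<d'. x b ^ m) = (\<Sum>m<d'. \<Sum>b<d. x b ^ m)" by (rule sum.swap)
  also have "\<dots> = (\<Sum>m<d'. if m = 0 then of_nat d else 0)" by (intro sum.cong char) auto
  also have "\<dots> = of_nat d" using k' by (simp add: sum.delta)
  also have "of_nat d / (1 - Q) - of_nat d = of_nat d * (Q / (1 - Q))"
    using Q1 by (simp add: field_simps)
  also have "Q / (1 - Q) = lambert (of_nat k' * w)"
    by (simp add: lambert_def Q_def)
  finally show ?thesis by (simp add: k'_def)
qed

text \<open>
  These are the identities needed to invert \<open>((a, d), k) \<mapsto> (n div gcd k d, k * a div gcd k d)\<close>: from
  \<open>(c, N)\<close> one recovers \<open>a = gcd N c\<close>, \<open>d = n div a\<close> and \<open>k = N * (n div c) div a\<close>.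
\<close>
lemma gcd_divisor_pair:
  fixes c N n :: nat
  assumes n: "n > 0" and c: "c dvd n" and N: "N > 0"
  defines "a \<equiv> gcd N c"
  shows "a dvd n" "gcd (N * (n div c) div a) (n div a) = n div c" "N * (n div c) div a > 0"
    "n div (n div c) = c"
proof -
  obtain m where m: "n = c * m" using c by auto
  have c0: "c > 0" "m > 0" using m n by auto
  obtain N' c' where Nc: "N = a * N'" "c = a * c'" "coprime N' c'"
    unfolding a_def using gcd_coprime_exists[of N c] c0 by (auto simp: mult.commute)
  have a0: "a > 0" using c0 by (simp add: a_def)
  have 1: "N * (n div c) div a = N' * m" "n div a = c' * m" "n div c = m"
    using Nc a0 c0 m by simp_all
  show "a dvd n" using Nc(2) m by simp
  show "gcd (N * (n div c) div a) (n div a) = n div c"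
    unfolding 1(1) 1(2) unfolding 1(3) using Nc(3) by (simp add: gcd_mult_distrib_nat[symmetric] mult.commute[of _ m])
  show "N * (n div c) div a > 0" using 1 N Nc c0 by (auto intro!: Nat.gr0I)
  show "n div (n div c) = c" using 1 m c0 by simp
qed

lemma finite_factorizations: "n > 0 \<Longrightarrow> finite {(a, d). a * d = (n :: nat)}"
proof -
  assume n: "n > 0"
  have "{(a, d). a * d = n} \<subseteq> {..n} \<times> {..n}"
    using n by (auto simp: Suc_le_eq)
  thus ?thesis by (rule finite_subset) auto
qed

lemma has_sum_finite_sum:
  fixes f :: "'b \<Rightarrow> 'a \<Rightarrow> 'c :: topological_comm_monoid_add"
  assumes "finite B" and "\<And>b. b \<in> B \<Longrightarrow> (f b has_sum s b) A"
  shows "((\<lambda>x. \<Sum>b\<in>B. f b x) has_sum (\<Sum>b\<in>B. s b)) A"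
  using assms by (induction B rule: finite_induct) (auto intro: has_sum_add)

text \<open>
  The distribution relation replaces the sum over \<open>b\<close> by \<open>lambert ((k * a div gcd k d) * z)\<close>. For
  \<open>c = n div gcd k d\<close> and \<open>N = k * a div gcd k d\<close>, the triples \<open>(a, d, k)\<close> correspond bijectively to the pairs
  \<open>(c, N)\<close> with \<open>c\<close> a divisor of \<open>n\<close>; so every \<open>N\<close> is hit once for each divisor. The constant term of
  \<^const>\<open>eis\<close> is multiplied by the same number, as each factorization contributes it once.
\<close>
lemma eis_Hecke:
  assumes n: "n > 0" and z: "Im z > 0"
  shows "(\<Sum>(a, d) | a * d = n. (\<Sum>b<d. eis ((of_nat a * z + of_nat b) / of_nat d)) / of_nat d)
           = of_nat (card {d. d dvd n}) * eis z"
proof -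
  define P where "P = {(a, d). a * d = n}"
  define K where "K = ({0<..} :: nat set)"
  define G where "G = eis z + 1 / 4"
  define g where "g = (\<lambda>((a, d), k). lambert (of_nat (k div gcd k d) * (of_nat a * z)))"
  define i where "i = (\<lambda>((a, d), k). (n div gcd k d, k * a div gcd k d))"
  define j where "j = (\<lambda>(c, N). ((gcd N c, n div gcd N c), N * (n div c) div gcd N c))"
  define \<delta> where "\<delta> = card {d. d dvd n}"
  have finP: "finite P" unfolding P_def by (rule finite_factorizations[OF n])
  have finD: "finite {c. c dvd n}" using n by simp
  have cardP: "card P = \<delta>" unfolding \<delta>_def
    by (rule bij_betw_same_card[of fst], rule bij_betwI[where g = "\<lambda>a. (a, n div a)"]) (use n in \<open>auto simp: P_def\<close>)
  have G: "((\<lambda>k. lambert (of_nat k * z)) has_sum G) K"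
    unfolding G_def K_def by (rule eis_has_sum[OF z])
  have "((\<lambda>(c, N). lambert (of_nat N * z)) has_sum (of_nat \<delta> * G)) ({c. c dvd n} \<times> K)"
  proof (rule has_sum_SigmaI)
    show "((\<lambda>N. case (c, N) of (c, N) \<Rightarrow> lambert (of_nat N * z)) has_sum G) K" for c :: nat
      using G by simp
    show "((\<lambda>_. G) has_sum (of_nat \<delta> * G)) {c. c dvd n}"
      using finD by (intro has_sum_finiteI) (simp_all add: \<delta>_def)
    have "(\<lambda>N. norm (lambert (of_nat N * z))) summable_on K"
      using has_sum_imp_summable[OF G] by (simp only: summable_on_iff_abs_summable_on_complex)
    hence "(\<lambda>p. norm (case p of (c, N) \<Rightarrow> lambert (of_nat N * z))) summable_on ({c. c dvd n} \<times> K)"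
      unfolding Infinite_Sum.abs_summable_on_Sigma_iff using finD by (auto intro!: summable_on_finite)
    thus "(\<lambda>(c, N). lambert (of_nat N * z)) summable_on ({c. c dvd n} \<times> K)"
      by (rule abs_summable_summable)
  qed
  also have "?this \<longleftrightarrow> (g has_sum (of_nat \<delta> * G)) (P \<times> K)"
  proof (rule has_sum_reindex_bij_witness[of _ i j])
    fix p assume "p \<in> {c. c dvd n} \<times> K"
    then obtain c N where p: "p = (c, N)" "c dvd n" "N > 0" by (auto simp: K_def)
    note * = gcd_divisor_pair[OF n p(2) p(3)]
    have c0: "c > 0" using p n by (auto intro: Nat.gr0I)
    obtain m where m: "n = c * m" using p by auto
    have m0: "m > 0" using m n by (auto intro: Nat.gr0I)
    have "gcd N c dvd N * (n div c)" by (simp add: dvd_mult2)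
    hence 2: "N * (n div c) div gcd N c * gcd N c div (n div c) = N"
      using m c0 m0 by simp
    show "i (j p) = p"
      using * 2 by (simp add: p(1) i_def j_def)
    show "j p \<in> P \<times> K"
      using * by (simp add: p(1) P_def K_def j_def)
    have "N * (n div c) div gcd N c div (n div c) * gcd N c = N"
    proof -
      have "N * (n div c) div gcd N c div (n div c) = N div gcd N c"
        using m c0 m0 by (simp add: div_mult2_eq[symmetric] mult.commute)
      thus ?thesis by simp
    qed
    hence "of_nat (N * (n div c) div gcd N c div (n div c)) * of_nat (gcd N c) = complex_of_nat N"
      by (simp only: of_nat_mult[symmetric])
    thus "g (j p) = (case p of (c, N) \<Rightarrow> lambert (of_nat N * z))"
      unfolding p(1) g_def j_def prod.case *(2) mult.assoc[symmetric] by (simp only:)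
  next
    fix q assume "q \<in> P \<times> K"
    then obtain a d k where q: "q = ((a, d), k)" "a * d = n" "k > 0" by (auto simp: P_def K_def)
    have ad: "a > 0" "d > 0" using q n by (auto intro: Nat.gr0I)
    define e where "e = gcd k d"
    obtain k' d' where kd: "k = e * k'" "d = e * d'" "coprime k' d'"
      unfolding e_def using gcd_coprime_exists[of k d] ad by (auto simp: mult.commute)
    have e: "e > 0" using ad by (simp add: e_def)
    have pos: "k' > 0" "d' > 0" using kd ad q by (auto intro: Nat.gr0I)
    have 1: "n div e = a * d'" "k * a div e = k' * a" "n div (a * d') = e"
      unfolding q(2)[symmetric] kd(1,2) using e ad pos by (simp_all add: mult_ac)
    have 2: "gcd (k' * a) (a * d') = a"
      using kd(3) by (simp add: gcd_mult_distrib_nat[symmetric] mult.commute[of _ a])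
    have 3: "n div a = d" "k' * a * e div a = k" using q ad kd by (auto simp: mult_ac)
    show "j (i q) = q"
      unfolding q(1) i_def j_def prod.case e_def[symmetric] 1 2 3 ..
    show "i q \<in> {c. c dvd n} \<times> K"
      unfolding q(1) i_def prod.case e_def[symmetric] 1 using q kd pos ad by (auto simp: K_def)
  qed auto
  finally have "(g has_sum (of_nat \<delta> * G)) (P \<times> K)" .
  hence "((\<lambda>(a, d). (\<Sum>b<d. eis ((of_nat a * z + of_nat b) / of_nat d) + 1 / 4) / of_nat d) has_sum (of_nat \<delta> * G)) P"
  proof (rule has_sum_SigmaD)
    fix p assume "p \<in> P"
    then obtain a d where p: "p = (a, d)" "a * d = n" by (auto simp: P_def)
    have ad: "a > 0" "d > 0" using p n by (auto intro: Nat.gr0I)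
    have "((\<lambda>k. \<Sum>b<d. lambert (of_nat k * ((of_nat a * z + of_nat b) / of_nat d))) has_sum
            (\<Sum>b<d. eis ((of_nat a * z + of_nat b) / of_nat d) + 1 / 4)) K"
      unfolding K_def by (intro has_sum_finite_sum eis_has_sum) (use ad z in auto)
    hence "((\<lambda>k. (\<Sum>b<d. lambert (of_nat k * ((of_nat a * z + of_nat b) / of_nat d))) / of_nat d) has_sum
            ((\<Sum>b<d. eis ((of_nat a * z + of_nat b) / of_nat d) + 1 / 4) / of_nat d)) K"
      unfolding divide_inverse by (rule has_sum_cmult_left)
    also have "?this \<longleftrightarrow> ((\<lambda>k. lambert (of_nat (k div gcd k d) * (of_nat a * z))) has_sum
            ((\<Sum>b<d. eis ((of_nat a * z + of_nat b) / of_nat d) + 1 / 4) / of_nat d)) K"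
    proof (rule has_sum_cong)
      fix k assume k: "k \<in> K"
      have "Im (of_nat a * z) > 0" "k > 0" using k z ad by (simp_all add: K_def)
      note this(1) this(2) ad(2)
      from lambert_distribution[OF this]
      show "(\<Sum>b<d. lambert (of_nat k * ((of_nat a * z + of_nat b) / of_nat d))) / of_nat d
          = lambert (of_nat (k div gcd k d) * (of_nat a * z))"
        using ad by (simp only: nonzero_mult_div_cancel_left of_nat_eq_0_iff)
    qed
    finally show "((\<lambda>k. g (p, k)) has_sum
        (case p of (a, d) \<Rightarrow> (\<Sum>b<d. eis ((of_nat a * z + of_nat b) / of_nat d) + 1 / 4) / of_nat d)) K"
      by (simp add: p(1) g_def)
  qed
  hence "of_nat \<delta> * G = (\<Sum>(a, d)\<in>P. (\<Sum>b<d. eis ((of_nat a * z + of_nat b) / of_nat d) + 1 / 4) / of_nat d)"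
    using finP by (simp add: has_sum_finite_iff)
  also have "\<dots> = (\<Sum>(a, d)\<in>P. (\<Sum>b<d. eis ((of_nat a * z + of_nat b) / of_nat d)) / of_nat d + 1 / 4)"
    using n by (intro sum.cong) (auto simp: P_def sum.distrib add_divide_distrib intro: Nat.gr0I)
  also have "\<dots> = (\<Sum>(a, d)\<in>P. (\<Sum>b<d. eis ((of_nat a * z + of_nat b) / of_nat d)) / of_nat d) + of_nat \<delta> / 4"
    by (simp add: case_prod_unfold sum.distrib cardP)
  finally show ?thesis by (simp add: G_def P_def \<delta>_def algebra_simps)
qed

section \<open>Linear functionals on the Hecke ring\<close>

text \<open>
  The linear extension of a function on matrix classes to the Hecke ring.
\<close>
definition linext :: "(pmat \<Rightarrow> complex) \<Rightarrow> hring \<Rightarrow> complex" where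
  "linext h v = (\<Sum>M\<in>Poly_Mapping.keys v. of_rat (Poly_Mapping.lookup v M) * h M)"

lemma linext_superset:
  assumes "finite A" "Poly_Mapping.keys v \<subseteq> A"
  shows "linext h v = (\<Sum>M\<in>A. of_rat (Poly_Mapping.lookup v M) * h M)"
  unfolding linext_def using assms by (intro sum.mono_neutral_left) (auto simp: in_keys_iff)

lemma linext_add: "linext h (u + v) = linext h u + linext h v"
proof -
  define A where "A = Poly_Mapping.keys u \<union> Poly_Mapping.keys v"
  have A: "finite A" "Poly_Mapping.keys u \<subseteq> A" "Poly_Mapping.keys v \<subseteq> A" "Poly_Mapping.keys (u + v) \<subseteq> A"
    using Poly_Mapping.keys_add[of u v] by (auto simp: A_def)
  show ?thesis
    by (simp add: linext_superset[OF A(1) A(2)] linext_superset[OF A(1) A(3)] linext_superset[OF A(1) A(4)]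
        lookup_add of_rat_add algebra_simps sum.distrib)
qed

lemma linext_zero [simp]: "linext h 0 = 0"
  by (simp add: linext_def)

lemma linext_diff: "linext h (u - v) = linext h u - linext h v"
  using linext_add[of h "u - v" v] by simp

lemma linext_sum: "linext h (sum g A) = (\<Sum>x\<in>A. linext h (g x))"
  by (induction A rule: infinite_finite_induct) (simp_all add: linext_add)

lemma linext_single: "linext h (Poly_Mapping.single M c) = of_rat c * h M"
  using linext_superset[of "{M}" "Poly_Mapping.single M c" h] by simp

lemma sum_single_lookup:
  "(\<Sum>M\<in>Poly_Mapping.keys v. Poly_Mapping.single M (Poly_Mapping.lookup v M)) = v"
  by (rule poly_mapping_eqI)
     (auto simp: lookup_sum lookup_single when_def in_keys_iff sum.delta)

lemma linext_basis_mult: "linext h (basis A * v) = linext (\<lambda>M. h (pmat_class A + M)) v"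
proof -
  have "linext h (basis A * v) =
      linext h (basis A * (\<Sum>M\<in>Poly_Mapping.keys v. Poly_Mapping.single M (Poly_Mapping.lookup v M)))"
    by (simp only: sum_single_lookup)
  also have "\<dots> = linext (\<lambda>M. h (pmat_class A + M)) v"
    by (simp only: basis_def sum_distrib_left mult_single linext_sum linext_single mult_1) (simp add: linext_def)
  finally show ?thesis .
qed

lemma linext_mult_basis: "linext h (v * basis A) = linext (\<lambda>M. h (M + pmat_class A)) v"
proof -
  have "linext h (v * basis A) =
      linext h ((\<Sum>M\<in>Poly_Mapping.keys v. Poly_Mapping.single M (Poly_Mapping.lookup v M)) * basis A)"
    by (simp only: sum_single_lookup)
  also have "\<dots> = linext (\<lambda>M. h (M + pmat_class A)) v"
    by (simp only: basis_def sum_distrib_right mult_single linext_sum linext_single mult_1_right) (simp add: linext_def)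
  finally show ?thesis .
qed

section \<open>The slash operator with a fixed sign\<close>

lemma imat_nth [simp]:
  "imat a b c d $ 1 $ 1 = a" "imat a b c d $ 1 $ 2 = b" "imat a b c d $ 2 $ 1 = c" "imat a b c d $ 2 $ 2 = d"
  by (simp_all add: imat_def)

lemma det_imat [simp]: "det (imat a b c d) = a * d - b * c"
  by (simp add: det_2)

lemma mult_nth_2: "(A ** B) $ i $ j = A $ i $ 1 * B $ 1 $ j + A $ i $ 2 * B $ 2 $ j" for A B :: imat2
  by (simp add: matrix_matrix_mult_def sum_2)

text \<open>
  In weight \<open>1\<close> the slash operator changes sign under \<open>A \<mapsto> - A\<close>, so one of the two signs has to be fixed. For the
  upper half plane the lower row is taken to be lexicographically positive. The matrices in the defining
  relation of Hecke operators on periods behave well: left multiplication by \<open>T\<close> keeps the lower row, left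
  multiplication by \<open>S\<close> makes the upper row of \<open>A\<close> the lower one, which is harmless if \<open>A\<close> has non-negative entries,
  and right multiplication by \<open>S\<close> keeps upper triangular matrices with positive diagonal canonical.
\<close>
definition canonical :: "imat2 \<Rightarrow> bool" where
  "canonical A \<longleftrightarrow> A $ 2 $ 1 > 0 \<or> (A $ 2 $ 1 = 0 \<and> A $ 2 $ 2 > 0)"

lemma pmat_class_eq_iff: "pmat_class A = pmat_class B \<longleftrightarrow> A = B \<or> A = - B"
  by (rule pmat.abs_eq_iff)

lemma pmat_rep_class: "pmat_rep (pmat_class A) = A \<or> pmat_rep (pmat_class A) = - A"
  using Quotient_rep_abs[OF Quotient_pmat, of A] by auto

lemma slash_uminus: "slash 1 f (- A) z = - slash 1 f A z"
proof -
  define a b c d where "a = complex_of_int (A $ 1 $ 1)" and "b = complex_of_int (A $ 1 $ 2)"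
    and "c = complex_of_int (A $ 2 $ 1)" and "d = complex_of_int (A $ 2 $ 2)"
  define w where "w = c * z + d"
  have 1: "- a * z + - b = - (a * z + b)" "- c * z + - d = - w" by (simp_all add: w_def)
  have "det (- A) = det A" by (simp add: det_2)
  thus ?thesis
    unfolding slash_def Let_def a_def[symmetric] b_def[symmetric] c_def[symmetric] d_def[symmetric]
      vector_uminus_component of_int_minus 1 w_def[symmetric] minus_divide_divide power_int_1_right
    by simp
qed

text \<open>
  The slash operator on a class, evaluated at its canonical representative.
\<close>
definition signed_slash :: "(complex \<Rightarrow> complex) \<Rightarrow> complex \<Rightarrow> pmat \<Rightarrow> complex" where
  "signed_slash f z M = (if canonical (pmat_rep M) then slash 1 f (pmat_rep M) z else - slash 1 f (pmat_rep M) z)"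

lemma signed_slash_class:
  assumes "canonical A"
  shows "signed_slash f z (pmat_class A) = slash 1 f A z"
proof -
  have "\<not> canonical (- A)" using assms by (auto simp: canonical_def)
  thus ?thesis using pmat_rep_class[of A] assms by (auto simp: signed_slash_def slash_uminus)
qed

lemma canonical_rep:
  assumes "pdet M > 0"
  obtains A where "pmat_class A = M" "canonical A" "det A = pdet M"
proof -
  define B where "B = pmat_rep M"
  have B: "pmat_class B = M" unfolding B_def by (rule Quotient_abs_rep[OF Quotient_pmat])
  have det: "det B = pdet M" "det (- B) = pdet M" using pdet.abs_eq[of B] by (simp_all add: B det_2)
  have M: "pmat_class (- B) = M" using B pmat_class_eq_iff[of "- B" B] by simp
  have "B $ 2 $ 1 \<noteq> 0 \<or> B $ 2 $ 2 \<noteq> 0" using det(1) assms by (auto simp: det_2)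
  hence "canonical B \<or> canonical (- B)" by (auto simp: canonical_def)
  thus thesis using that B M det by blast
qed

definition mobius_act :: "imat2 \<Rightarrow> complex \<Rightarrow> complex" where
  "mobius_act A z = (of_int (A $ 1 $ 1) * z + of_int (A $ 1 $ 2)) / (of_int (A $ 2 $ 1) * z + of_int (A $ 2 $ 2))"

lemma slash_1: "slash 1 f A z = of_real (sqrt (real_of_int (det A))) / (of_int (A $ 2 $ 1) * z + of_int (A $ 2 $ 2))
    * f (mobius_act A z)" if "det A > 0"
  using that by (simp add: slash_def mobius_act_def Let_def powr_half_sqrt)

lemma denom_nonzero:
  fixes A :: imat2
  assumes "det A > 0" "Im z > 0"
  shows "of_int (A $ 2 $ 1) * z + of_int (A $ 2 $ 2) \<noteq> 0"
proof
  assume *: "of_int (A $ 2 $ 1) * z + of_int (A $ 2 $ 2) = 0"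
  hence "Im (of_int (A $ 2 $ 1) * z + of_int (A $ 2 $ 2)) = 0" by simp
  hence "A $ 2 $ 1 = 0" using assms(2) by simp
  moreover from this * have "A $ 2 $ 2 = 0" by simp
  ultimately show False using assms(1) by (simp add: det_2)
qed

lemma Im_mobius_act_pos:
  assumes "det A > 0" "Im z > 0"
  shows "Im (mobius_act A z) > 0"
proof -
  define a b c d where "a = real_of_int (A $ 1 $ 1)" and "b = real_of_int (A $ 1 $ 2)"
    and "c = real_of_int (A $ 2 $ 1)" and "d = real_of_int (A $ 2 $ 2)"
  define w where "w = of_real c * z + complex_of_real d"
  have w: "w \<noteq> 0" using denom_nonzero[OF assms] by (simp add: w_def c_def d_def)
  have "real_of_int (det A) = a * d - b * c" by (simp add: det_2 a_def b_def c_def d_def)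
  hence det: "a * d - b * c > 0" using assms(1) by (metis of_int_0_less_iff)
  have "Im (mobius_act A z) = Im ((of_real a * z + of_real b) / w)"
    by (simp add: mobius_act_def w_def a_def b_def c_def d_def)
  also have "\<dots> = (a * d - b * c) * Im z / (norm w)\<^sup>2"
    by (simp add: Im_divide cmod_def w_def algebra_simps)
  also have "\<dots> > 0" using det assms(2) w by simp
  finally show ?thesis .
qed

lemma slash_mult:
  assumes "det A > 0" "det B > 0" "Im z > 0"
  shows "slash 1 f (A ** B) z = slash 1 (slash 1 f A) B z"
proof -
  define jB where "jB = of_int (B $ 2 $ 1) * z + complex_of_int (B $ 2 $ 2)"
  define w where "w = mobius_act B z"
  have jB: "jB \<noteq> 0" unfolding jB_def by (rule denom_nonzero[OF assms(2,3)])
  have w: "Im w > 0" unfolding w_def by (rule Im_mobius_act_pos[OF assms(2,3)])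
  define jA where "jA = of_int (A $ 2 $ 1) * w + complex_of_int (A $ 2 $ 2)"
  have jA: "jA \<noteq> 0" unfolding jA_def by (rule denom_nonzero[OF assms(1) w])
  have wj: "w * jB = of_int (B $ 1 $ 1) * z + of_int (B $ 1 $ 2)" using jB by (simp add: w_def mobius_act_def jB_def)
  have den: "of_int ((A ** B) $ 2 $ 1) * z + of_int ((A ** B) $ 2 $ 2) = jA * jB"
  proof -
    have "jA * jB = of_int (A $ 2 $ 1) * (w * jB) + of_int (A $ 2 $ 2) * jB" by (simp add: jA_def algebra_simps)
    thus ?thesis unfolding wj by (simp add: jB_def mult_nth_2 algebra_simps)
  qed
  have num: "of_int ((A ** B) $ 1 $ 1) * z + of_int ((A ** B) $ 1 $ 2) = (of_int (A $ 1 $ 1) * w + of_int (A $ 1 $ 2)) * jB"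
  proof -
    have "(of_int (A $ 1 $ 1) * w + of_int (A $ 1 $ 2)) * jB = of_int (A $ 1 $ 1) * (w * jB) + of_int (A $ 1 $ 2) * jB"
      by (simp add: algebra_simps)
    thus ?thesis unfolding wj by (simp add: jB_def mult_nth_2 algebra_simps)
  qed
  have mo: "mobius_act (A ** B) z = mobius_act A w"
    unfolding mobius_act_def[of "A ** B"] den num using jB by (simp add: mobius_act_def jA_def)
  have det: "det (A ** B) = det A * det B" by (rule det_mul)
  have "det (A ** B) > 0" using assms det by simp
  thus ?thesis
    unfolding slash_1[OF \<open>det (A ** B) > 0\<close>] slash_1[OF assms(1)] slash_1[OF assms(2)] mo den det
      jB_def[symmetric] w_def[symmetric] jA_def[symmetric]
    by (simp add: real_sqrt_mult mult_ac)
qed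

abbreviation "Smat \<equiv> imat 0 (-1) 1 0"
abbreviation "Tmat \<equiv> imat 1 1 0 1"

lemma slash_Smat: "slash 1 f Smat z = f (- 1 / z) / z"
  by (simp add: slash_1 mobius_act_def)

lemma slash_Tmat: "slash 1 f Tmat z = f (z + 1)"
  by (simp add: slash_1 mobius_act_def)

section \<open>Hecke operators acting on the period relation\<close>

lemma eis_periodic: "eis (z + 1) = eis z"
proof -
  have "lambert (of_nat k * (z + 1)) = lambert (of_nat k * z)" for k
  proof -
    have "exp (2 * of_real pi * \<i> * (of_nat k * (z + 1)))
        = exp (2 * of_real pi * \<i> * (of_nat k * z) + 2 * of_nat k * of_real pi * \<i>)"
      by (intro arg_cong[of _ _ exp]) (simp add: algebra_simps)
    also have "\<dots> = exp (2 * of_real pi * \<i> * (of_nat k * z))"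
      unfolding exp_add using exp_integer_2pi[of "of_nat k"] by simp
    finally show ?thesis unfolding lambert_def of_real_mult of_real_numeral by (simp only:)
  qed
  thus ?thesis by (simp add: eis_def)
qed

lemma pmat_class_add: "pmat_class A + pmat_class B = pmat_class (A ** B)"
  by (rule plus_pmat.abs_eq)

lemma signed_slash_T_invariant:
  assumes "pdet M > 0" "Im z > 0"
  shows "signed_slash eis z (pmat_class Tmat + M) = signed_slash eis z M"
proof -
  obtain A where A: "pmat_class A = M" "canonical A" "det A = pdet M"
    using canonical_rep[OF assms(1)] .
  have det: "det A > 0" using A assms by simp
  have can: "canonical (Tmat ** A)" using A(2) by (auto simp: canonical_def mult_nth_2)
  have "signed_slash eis z (pmat_class Tmat + M) = slash 1 eis (Tmat ** A) z"
    unfolding A(1)[symmetric] pmat_class_add by (rule signed_slash_class[OF can])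
  also have "\<dots> = slash 1 (slash 1 eis Tmat) A z" by (rule slash_mult) (use det assms in simp_all)
  also have "slash 1 eis Tmat = eis" by (simp add: fun_eq_iff slash_Tmat eis_periodic)
  also have "slash 1 eis A z = signed_slash eis z M" using signed_slash_class[OF A(2)] A(1) by simp
  finally show ?thesis .
qed

text \<open>
  Non-negative entries make \<open>A\<close> and \<open>S ** A\<close> both canonical, so that no sign
  intervenes when the period relation is pulled back along \<open>A\<close>.
\<close>
lemma slash_F1_eq:
  assumes "nonneg_mat A" "det A > 0" "Im z > 0"
  shows "slash 1 F1 A z = pi * \<i> * (signed_slash eis z (pmat_class A) - signed_slash eis z (pmat_class Smat + pmat_class A))"
proof -
  have nn: "A $ 1 $ 1 \<ge> 0" "A $ 1 $ 2 \<ge> 0" "A $ 2 $ 1 \<ge> 0" "A $ 2 $ 2 \<ge> 0"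
    using assms(1) by (simp_all add: nonneg_mat_def)
  have det: "A $ 1 $ 1 * A $ 2 $ 2 - A $ 1 $ 2 * A $ 2 $ 1 > 0" using assms(2) by (simp add: det_2)
  have "canonical A" "canonical (Smat ** A)"
    using nn det by (auto simp: canonical_def mult_nth_2 less_le)
  hence "signed_slash eis z (pmat_class A) - signed_slash eis z (pmat_class Smat + pmat_class A)
       = slash 1 eis A z - slash 1 (slash 1 eis Smat) A z"
    unfolding pmat_class_add using assms by (simp add: signed_slash_class slash_mult)
  also have "\<dots> = of_real (sqrt (real_of_int (det A))) / (of_int (A $ 2 $ 1) * z + of_int (A $ 2 $ 2))
        * (eis (mobius_act A z) - eis (- 1 / mobius_act A z) / mobius_act A z)"
    unfolding slash_1[OF assms(2)] slash_Smat by (simp only: right_diff_distrib)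
  finally show ?thesis
    unfolding slash_1[OF assms(2)] F1_eq_eis[OF Im_mobius_act_pos[OF assms(2,3)]] by (simp only: mult_ac)
qed

lemma slash_T_inf:
  assumes n: "n > 0" and z: "Im z > 0"
  shows "(\<Sum>(a, d) | a * d = n. \<Sum>b<d. slash 1 eis (imat (int a) (int b) 0 (int d)) z)
          = of_real (sqrt (real n)) * of_nat (card {d. d dvd n}) * eis z"
proof -
  have "(\<Sum>b<d. slash 1 eis (imat (int a) (int b) 0 (int d)) z)
      = of_real (sqrt (real n)) * ((\<Sum>b<d. eis ((of_nat a * z + of_nat b) / of_nat d)) / of_nat d)" if "a * d = n" for a d
  proof -
    have "det (imat (int a) (int b) 0 (int d)) = int n" for b using that by auto
    thus ?thesis using n by (simp add: slash_1 mobius_act_def sum_distrib_left sum_divide_distrib)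
  qed
  hence "(\<Sum>(a, d) | a * d = n. \<Sum>b<d. slash 1 eis (imat (int a) (int b) 0 (int d)) z)
      = (\<Sum>(a, d) | a * d = n. of_real (sqrt (real n)) * ((\<Sum>b<d. eis ((of_nat a * z + of_nat b) / of_nat d)) / of_nat d))"
    by (intro sum.cong) auto
  also have "\<dots> = of_real (sqrt (real n)) * (\<Sum>(a, d) | a * d = n. (\<Sum>b<d. eis ((of_nat a * z + of_nat b) / of_nat d)) / of_nat d)"
    by (simp add: sum_distrib_left case_prod_unfold)
  finally show ?thesis unfolding eis_Hecke[OF n z] by (simp add: mult.assoc)
qed

lemma linext_T_inf: "linext h (T_inf n) = (\<Sum>(a, d) | a * d = n. \<Sum>b<d. h (pmat_class (imat (int a) (int b) 0 (int d))))"
  by (simp add: T_inf_def linext_sum case_prod_unfold basis_def linext_single)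

lemma linext_T_inf_one_minus_S:
  assumes n: "n > 0" and z: "Im z > 0"
  shows "linext (signed_slash eis z) (T_inf n * (1 - S)) =
           of_real (sqrt (real n)) * of_nat (card {d. d dvd n}) * (eis z - eis (- 1 / z) / z)"
proof -
  have z': "Im (- 1 / z) > 0" using Im_mobius_act_pos[of Smat z] z by (simp add: mobius_act_def)
  have pos: "d > 0" if "a * d = n" for a d using that n by (auto intro: Nat.gr0I)
  have det: "det (imat (int a) (int b) 0 (int d)) > 0" if "a * d = n" for a b d
    using that n by (auto simp flip: of_nat_mult)
  have 1: "linext (signed_slash eis z) (T_inf n) = (\<Sum>(a, d) | a * d = n. \<Sum>b<d. slash 1 eis (imat (int a) (int b) 0 (int d)) z)"
    unfolding linext_T_inf by (intro sum.cong refl) (auto simp: signed_slash_class canonical_def pos intro!: sum.cong)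
  have "signed_slash eis z (pmat_class (imat (int a) (int b) 0 (int d)) + pmat_class Smat)
      = slash 1 eis (imat (int a) (int b) 0 (int d)) (- 1 / z) / z" if "a * d = n" for a b d
  proof -
    have "canonical (imat (int a) (int b) 0 (int d) ** Smat)"
      using pos[OF that] by (simp add: canonical_def mult_nth_2)
    moreover have "det Smat > 0" by simp
    ultimately show ?thesis
      unfolding pmat_class_add slash_Smat[symmetric] using det[OF that] z by (simp only: signed_slash_class slash_mult)
  qed
  hence 2: "linext (\<lambda>M. signed_slash eis z (M + pmat_class Smat)) (T_inf n)
      = (\<Sum>(a, d) | a * d = n. \<Sum>b<d. slash 1 eis (imat (int a) (int b) 0 (int d)) (- 1 / z)) / z"
    unfolding linext_T_inf sum_divide_distrib by (intro sum.cong refl) (auto simp: sum_divide_distrib intro!: sum.cong)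
  have "T_inf n * (1 - S) = T_inf n - T_inf n * basis Smat" by (simp add: S_def algebra_simps)
  hence "linext (signed_slash eis z) (T_inf n * (1 - S)) = linext (signed_slash eis z) (T_inf n) - linext (\<lambda>M. signed_slash eis z (M + pmat_class Smat)) (T_inf n)"
    by (simp only: linext_diff linext_mult_basis)
  thus ?thesis unfolding 1 2 slash_T_inf[OF n z] slash_T_inf[OF n z'] by (simp add: algebra_simps)
qed

lemma nonneg_rep_props:
  assumes "has_nonneg_rep M" "pdet M > 0"
  shows "pmat_class (nonneg_rep M) = M" "nonneg_mat (nonneg_rep M)" "det (nonneg_rep M) = pdet M"
proof -
  obtain A where A: "pmat_class A = M" "nonneg_mat A" using assms(1) by (auto simp: has_nonneg_rep_def)
  have detA: "det A = pdet M" using pdet.abs_eq[of A] A by simp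
  have "B = A" if B: "pmat_class B = M" "nonneg_mat B" for B
  proof (rule ccontr)
    assume "B \<noteq> A"
    hence BA: "B = - A" using B(1) A(1) pmat_class_eq_iff[of B A] by simp
    have "A $ i $ j = 0" for i j
    proof -
      have "A $ i $ j \<ge> 0" "B $ i $ j \<ge> 0" using A(2) B(2) by (simp_all add: nonneg_mat_def)
      thus ?thesis using BA by simp
    qed
    hence "det A = 0" by (simp add: det_2)
    thus False using detA assms(2) by simp
  qed
  note unique = this
  have eq: "nonneg_rep M = A"
    unfolding nonneg_rep_def
  proof (rule the_equality)
    show "pmat_class A = M \<and> nonneg_mat A" using A by (rule conjI)
    show "B = A" if "pmat_class B = M \<and> nonneg_mat B" for B
      using that by (intro unique) (rule conjunct1, assumption, rule conjunct2, assumption)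
  qed
  show "pmat_class (nonneg_rep M) = M" "nonneg_mat (nonneg_rep M)" "det (nonneg_rep M) = pdet M"
    unfolding eq by (rule A(1), rule A(2), rule detA)
qed

text \<open>
  The functional \<open>linext (signed_slash eis z)\<close> is applied to both sides of the defining relation. The term with
  \<open>1 - T\<close> vanishes by periodicity, and \<^const>\<open>T_inf\<close> acts on \<^const>\<open>eis\<close> by the eigenvalue.
\<close>
lemma slash_hring_F1_upper_half_plane:
  assumes n: "n > 0" and rep: "represents_Hecke n Tn"
    and nn: "\<forall>M\<in>Poly_Mapping.keys Tn. has_nonneg_rep M" and z: "Im z > 0"
  shows "slash_hring 1 F1 Tn z = of_real (sqrt (real n)) * of_nat (card {d. d dvd n}) * F1 z"
proof -
  obtain Y where deg: "Tn \<in> hring_deg n" "Y \<in> hring_deg n"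
    and eq: "(1 - S) * Tn = T_inf n * (1 - S) + (1 - T) * Y"
    using rep by (auto simp: represents_Hecke_def)
  have pdet: "pdet M > 0" if "M \<in> Poly_Mapping.keys Tn \<or> M \<in> Poly_Mapping.keys Y" for M
    using that deg n by (auto simp: hring_deg_def)
  have "slash_hring 1 F1 Tn z = pi * \<i> * (linext (signed_slash eis z) Tn - linext (\<lambda>M. signed_slash eis z (pmat_class Smat + M)) Tn)"
  proof -
    have "slash 1 F1 (nonneg_rep M) z = pi * \<i> * (signed_slash eis z M - signed_slash eis z (pmat_class Smat + M))"
      if M: "M \<in> Poly_Mapping.keys Tn" for M
    proof -
      note nr = nonneg_rep_props[OF bspec[OF nn M] pdet[OF disjI1[OF M]]]
      show ?thesis using slash_F1_eq[OF nr(2) _ z] nr pdet[OF disjI1[OF M]] by simp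
    qed
    thus ?thesis
      by (simp add: slash_hring_def linext_def sum_distrib_left right_diff_distrib mult_ac flip: sum_subtractf)
  qed
  also have "linext (signed_slash eis z) Tn - linext (\<lambda>M. signed_slash eis z (pmat_class Smat + M)) Tn = linext (signed_slash eis z) ((1 - S) * Tn)"
    by (simp add: S_def left_diff_distrib linext_diff linext_basis_mult)
  also have "\<dots> = linext (signed_slash eis z) (T_inf n * (1 - S)) + linext (signed_slash eis z) ((1 - T) * Y)"
    unfolding eq linext_add ..
  also have "linext (signed_slash eis z) ((1 - T) * Y) = linext (signed_slash eis z) Y - linext (\<lambda>M. signed_slash eis z (pmat_class Tmat + M)) Y"
    by (simp add: T_def left_diff_distrib linext_diff linext_basis_mult)
  also have "linext (\<lambda>M. signed_slash eis z (pmat_class Tmat + M)) Y = linext (signed_slash eis z) Y"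
    unfolding linext_def using pdet z by (intro sum.cong refl) (simp add: signed_slash_T_invariant)
  finally show ?thesis
    unfolding linext_T_inf_one_minus_S[OF n z] F1_eq_eis[OF z] by (simp add: mult_ac)
qed

text \<open>
  A matrix with non-negative entries and positive determinant maps the positive half line into itself,
  hence away from the branch cut.
\<close>
lemma isCont_slash_F1:
  assumes A: "nonneg_mat A" "det A > 0" and x: "x > 0"
  shows "isCont (slash 1 F1 A) (complex_of_real x)"
proof -
  define a b c d where "a = real_of_int (A $ 1 $ 1)" and "b = real_of_int (A $ 1 $ 2)"
    and "c = real_of_int (A $ 2 $ 1)" and "d = real_of_int (A $ 2 $ 2)"
  have nn: "a \<ge> 0" "b \<ge> 0" "c \<ge> 0" "d \<ge> 0"
    using A(1) by (simp_all add: nonneg_mat_def a_def b_def c_def d_def)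
  have "real_of_int (det A) = a * d - b * c" by (simp add: det_2 a_def b_def c_def d_def)
  hence det: "a * d - b * c > 0" using A(2) by (metis of_int_0_less_iff)
  have "a \<noteq> 0 \<or> b \<noteq> 0" "c \<noteq> 0 \<or> d \<noteq> 0" using det by auto
  moreover have "u * x + v > 0" if "u \<ge> 0" "v \<ge> 0" "u \<noteq> 0 \<or> v \<noteq> 0" for u v
    using that x by (cases "u = 0") (auto intro: add_pos_nonneg)
  ultimately have pos: "a * x + b > 0" "c * x + d > 0"
    using nn by blast+
  have den: "of_int (A $ 2 $ 1) * complex_of_real x + of_int (A $ 2 $ 2) = of_real (c * x + d)"
    by (simp add: c_def d_def)
  have mo: "mobius_act A (of_real x) = of_real ((a * x + b) / (c * x + d))"
    by (simp add: mobius_act_def a_def b_def c_def d_def)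
  have ne: "of_int (A $ 2 $ 1) * complex_of_real x + of_int (A $ 2 $ 2) \<noteq> 0"
    unfolding den using pos by (simp only: of_real_eq_0_iff)
  have "mobius_act A (of_real x) \<notin> \<real>\<^sub>\<le>\<^sub>0"
    unfolding mo nonpos_Reals_of_real_iff using pos by (simp add: not_le)
  hence F: "isCont F1 (mobius_act A (of_real x))" by (rule continuous_F1)
  have "isCont (mobius_act A) (of_real x)"
    unfolding mobius_act_def[abs_def] using ne by (intro continuous_intros) auto
  hence "isCont (\<lambda>z. F1 (mobius_act A z)) (of_real x)" using F by (rule isCont_o2)
  hence "isCont (\<lambda>z. of_real (sqrt (real_of_int (det A))) / (of_int (A $ 2 $ 1) * z + of_int (A $ 2 $ 2)) * F1 (mobius_act A z)) (of_real x)"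
    using ne by (intro continuous_intros) auto
  thus ?thesis unfolding slash_1[OF A(2), abs_def] .
qed

text \<open>
  At a positive real point both sides are limits from the upper half plane.
\<close>
theorem theorem3p1:
  fixes n :: nat and Tn :: hring and x :: real
  assumes "n > 0"
    and "represents_Hecke n Tn"
    and "\<forall>M\<in>Poly_Mapping.keys Tn. has_nonneg_rep M"
    and "x > 0"
  shows "slash_hring 1 F1 Tn (of_real x)
         = of_real (sqrt (real n)) * of_nat (card {d. d dvd n}) * F1 (of_real x)"
proof -
  define z where "z = (\<lambda>m. Complex x (1 / real (Suc m)))"
  have z: "z \<longlonglongrightarrow> of_real x"
  proof -
    have "z \<longlonglongrightarrow> Complex x 0"
      unfolding z_def by (intro tendsto_Complex tendsto_const LIMSEQ_Suc[OF lim_1_over_n])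
    thus ?thesis by (simp add: complex_of_real_def)
  qed
  have "of_real x \<notin> \<real>\<^sub>\<le>\<^sub>0" using assms(4) by (simp add: nonpos_Reals_of_real_iff)
  hence "(\<lambda>m. F1 (z m)) \<longlonglongrightarrow> F1 (of_real x)" by (intro isCont_tendsto_compose[OF continuous_F1 z])
  hence "(\<lambda>m. of_real (sqrt (real n)) * of_nat (card {d. d dvd n}) * F1 (z m))
      \<longlonglongrightarrow> of_real (sqrt (real n)) * of_nat (card {d. d dvd n}) * F1 (of_real x)"
    by (intro tendsto_intros)
  moreover have "(\<lambda>m. slash_hring 1 F1 Tn (z m)) \<longlonglongrightarrow> slash_hring 1 F1 Tn (of_real x)"
    unfolding slash_hring_def
  proof (intro tendsto_sum tendsto_mult tendsto_const)
    fix M assume M: "M \<in> Poly_Mapping.keys Tn"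
    have "pdet M > 0" using M assms(1,2) by (auto simp: represents_Hecke_def hring_deg_def)
    with nonneg_rep_props[OF bspec[OF assms(3) M]] assms(4)
    show "(\<lambda>m. slash 1 F1 (nonneg_rep M) (z m)) \<longlonglongrightarrow> slash 1 F1 (nonneg_rep M) (of_real x)"
      by (intro isCont_tendsto_compose[OF isCont_slash_F1 z]) auto
  qed
  moreover have "slash_hring 1 F1 Tn (z m) = of_real (sqrt (real n)) * of_nat (card {d. d dvd n}) * F1 (z m)" for m
    by (rule slash_hring_F1_upper_half_plane[OF assms(1,2,3)]) (simp add: z_def)
  ultimately show ?thesis using LIMSEQ_unique by simp
qed

end
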